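(* Let $G$ be a finitely generated group with an Anosov-like action on the skew plane $P_{\mathrm{skew}}$, and let $\mathrm{Free}\subset G$ be the set of elements acting freely on $P_{\mathrm{skew}}$. Then for every finite generating set $S$ of $G$, $\lambda_S(\mathrm{Free})=\lambda_S(G)$, and moreover $$\limsup_{n\to\infty}\frac{|\mathrm{Free}\cap B_S(n)|}{|B_S(n)|}>0.$$
   Context: The skew plane $P_{\mathrm{skew}}$ is the strip $\{(x,y): x<y<x+1\}\subset\mathbb R^2$ with the foliations $\mathcal F^+,\mathcal F^-$ induced by the horizontal and vertical foliations of $\mathbb R^2$. An automorphism is a homeomorphism sending leaves of $\mathcal F^+$ to leaves of $\mathcal F^+$ and leaves of $\mathcal F^-$ to leaves of $\mathcal F^-$. An action of $G$ by automorphisms is Anosov-like if: (A1) if a nontrivial $g\in G$ fixes a leaf $l$ of $\mathcal F^+$ or $\mathcal F^-$, then it has a fixed point $x\in l$ and is topologically expanding on one leaf through $x$ and topologically contracting on the other; (A2) the union of $\mathcal F^+$-leaves fixed by some nontrivial element of $G$ is dense, and likewise for $\mathcal F^-$; (A3) each singular point is fixed by some nontrivial element (vacuous here); (A4) any leaf nonseparated in its leaf space from another leaf is fixed by some nontrivial element (vacuous here). For a finite generating set $S$, $B_S(n)$ is the word-metric ball of radius $n$ about the identity, and for $A\subset G$ the critical exponent is $\lambda_S(A)=\limsup_{n\to\infty}\frac1n\log|A\cap B_S(n)|$. *)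

theory Defs
  imports "HOL-Analysis.Analysis" "HOL-Algebra.Group_Action" "HOL-Algebra.Generated_Groups" "HOL-Library.Liminf_Limsup"
begin

definition Pskew :: "(real \<times> real) set" where
  "Pskew = {(x, y). x < y \<and> y < x + 1}"

definition leaves_plus :: "(real \<times> real) set set" where
  "leaves_plus = {{p \<in> Pskew. snd p = c} | c. True}"

definition leaves_minus :: "(real \<times> real) set set" where
  "leaves_minus = {{p \<in> Pskew. fst p = c} | c. True}"

definition leaf_plus_through :: "real \<times> real \<Rightarrow> (real \<times> real) set" where
  "leaf_plus_through x = {p \<in> Pskew. snd p = snd x}"

definition leaf_minus_through :: "real \<times> real \<Rightarrow> (real \<times> real) set" where
  "leaf_minus_through x = {p \<in> Pskew. fst p = fst x}"

definition skew_automorphism :: "(real \<times> real \<Rightarrow> real \<times> real) \<Rightarrow> bool" where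
  "skew_automorphism f \<longleftrightarrow>
     (\<exists>f'. homeomorphism Pskew Pskew f f') \<and>
     (\<forall>l\<in>leaves_plus. f ` l \<in> leaves_plus) \<and>
     (\<forall>l\<in>leaves_minus. f ` l \<in> leaves_minus)"

definition topo_contracting ::
  "('g, 'b) monoid_scheme \<Rightarrow> ('g \<Rightarrow> real \<times> real \<Rightarrow> real \<times> real) \<Rightarrow> 'g
     \<Rightarrow> (real \<times> real) set \<Rightarrow> real \<times> real \<Rightarrow> bool" where
  "topo_contracting G \<phi> g l x \<longleftrightarrow>
     (\<forall>y\<in>l. (\<lambda>n::nat. \<phi> (g [^]\<^bsub>G\<^esub> n) y) \<longlonglongrightarrow> x)"

definition topo_expanding ::
  "('g, 'b) monoid_scheme \<Rightarrow> ('g \<Rightarrow> real \<times> real \<Rightarrow> real \<times> real) \<Rightarrow> 'g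
     \<Rightarrow> (real \<times> real) set \<Rightarrow> real \<times> real \<Rightarrow> bool" where
  "topo_expanding G \<phi> g l x \<longleftrightarrow> topo_contracting G \<phi> (inv\<^bsub>G\<^esub> g) l x"

definition saturated :: "(real \<times> real) set set \<Rightarrow> (real \<times> real) set \<Rightarrow> bool" where
  "saturated F U \<longleftrightarrow> (\<forall>l\<in>F. l \<inter> U \<noteq> {} \<longrightarrow> l \<subseteq> U)"

text \<open>Two distinct leaves are nonseparated in the leaf space (quotient topology) iff
  every two open saturated neighbourhoods of them intersect.\<close>
definition nonseparated :: "(real \<times> real) set set \<Rightarrow> (real \<times> real) set \<Rightarrow> (real \<times> real) set \<Rightarrow> bool" where
  "nonseparated F l l' \<longleftrightarrow> l \<in> F \<and> l' \<in> F \<and> l \<noteq> l' \<and>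
     (\<forall>U V. openin (top_of_set Pskew) U \<longrightarrow> openin (top_of_set Pskew) V \<longrightarrow>
        saturated F U \<longrightarrow> saturated F V \<longrightarrow> l \<subseteq> U \<longrightarrow> l' \<subseteq> V \<longrightarrow> U \<inter> V \<noteq> {})"

definition fixes_leaf :: "('g, 'b) monoid_scheme \<Rightarrow> ('g \<Rightarrow> real \<times> real \<Rightarrow> real \<times> real) \<Rightarrow> 'g
     \<Rightarrow> (real \<times> real) set \<Rightarrow> bool" where
  "fixes_leaf G \<phi> g l \<longleftrightarrow> g \<in> carrier G \<and> g \<noteq> \<one>\<^bsub>G\<^esub> \<and> \<phi> g ` l = l"

definition anosov_like ::
  "('g, 'b) monoid_scheme \<Rightarrow> ('g \<Rightarrow> real \<times> real \<Rightarrow> real \<times> real) \<Rightarrow> bool" where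
  "anosov_like G \<phi> \<longleftrightarrow>
     group_action G Pskew \<phi> \<and>
     (\<forall>g\<in>carrier G. skew_automorphism (\<phi> g)) \<and>
     \<comment> \<open>(A1)\<close>
     (\<forall>g l. (l \<in> leaves_plus \<or> l \<in> leaves_minus) \<and> fixes_leaf G \<phi> g l \<longrightarrow>
        (\<exists>x\<in>l. \<phi> g x = x \<and>
           ((topo_expanding G \<phi> g (leaf_plus_through x) x \<and> topo_contracting G \<phi> g (leaf_minus_through x) x) \<or>
            (topo_contracting G \<phi> g (leaf_plus_through x) x \<and> topo_expanding G \<phi> g (leaf_minus_through x) x)))) \<and>
     \<comment> \<open>(A2)\<close>
     Pskew \<subseteq> closure (\<Union>{l \<in> leaves_plus. \<exists>g. fixes_leaf G \<phi> g l}) \<and>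
     Pskew \<subseteq> closure (\<Union>{l \<in> leaves_minus. \<exists>g. fixes_leaf G \<phi> g l}) \<and>
     \<comment> \<open>(A3): the skew plane has no singular points, so this condition is vacuous.\<close>
     \<comment> \<open>(A4)\<close>
     (\<forall>F\<in>{leaves_plus, leaves_minus}. \<forall>l l'. nonseparated F l l' \<longrightarrow>
        (\<exists>g. fixes_leaf G \<phi> g l))"

definition acts_freely :: "('g \<Rightarrow> real \<times> real \<Rightarrow> real \<times> real) \<Rightarrow> 'g \<Rightarrow> bool" where
  "acts_freely \<phi> g \<longleftrightarrow> (\<forall>x\<in>Pskew. \<phi> g x \<noteq> x)"

definition word_ball :: "('g, 'b) monoid_scheme \<Rightarrow> 'g set \<Rightarrow> nat \<Rightarrow> 'g set" where
  "word_ball G S n = {foldr (\<otimes>\<^bsub>G\<^esub>) w \<one>\<^bsub>G\<^esub> | w.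
      set w \<subseteq> S \<union> (\<lambda>s. inv\<^bsub>G\<^esub> s) ` S \<and> length w \<le> n}"

definition crit_exp :: "('g, 'b) monoid_scheme \<Rightarrow> 'g set \<Rightarrow> 'g set \<Rightarrow> ereal" where
  "crit_exp G S A = limsup (\<lambda>n. ereal (ln (real (card (A \<inter> word_ball G S n))) / real n))"

definition finite_generating_set :: "('g, 'b) monoid_scheme \<Rightarrow> 'g set \<Rightarrow> bool" where
  "finite_generating_set G S \<longleftrightarrow> finite S \<and> S \<subseteq> carrier G \<and> generate G S = carrier G"

end

theory Submission
  imports Defs
begin

text \<open>
  An automorphism of the strip has the form $(x, y) \mapsto (a(x), b(y))$, and when $a$ increases,
  $b = a$ and $a(x + 1) = a(x) + 1$. So an index at most two subgroup of $G$ acts on the line by lifts of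
  circle homeomorphisms, and (A1) says that a nontrivial lift with a fixed point has exactly one
  attracting and one repelling fixed point on the circle.

  Two lifts sharing a fixed point $c$ have the same fixed points: comparing elements of the stabiliser of $c$
  near $c + 1$ gives a bi-invariant order, which is Archimedean if the stabiliser has two elements with
  different fixed points; by Hoelder's theorem the stabiliser would then be abelian, which is absurd.
  By (A2) there are therefore two lifts without common fixed points, and a ping-pong argument
  produces an element $h$ moving every point in the same direction; a power of it satisfies
  $h(x) \ge x + 1$. If an increasing lift $g$ has a fixed point then $g(x) > x - 1$, so $h g$ is free.
  Together with one orientation-reversing element this shows that finitely many two-sided
  translates of Free cover $G$, so that Free has positive proportion in all large balls.
\<close>

section \<open>Archimedean bi-ordered groups are abelian\<close>

locale biordered_group = group G for G (structure) +
  fixes less :: "'a \<Rightarrow> 'a \<Rightarrow> bool" (infix "\<triangleleft>" 50)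
  assumes irrefl: "x \<in> carrier G \<Longrightarrow> \<not> x \<triangleleft> x"
    and trans: "\<lbrakk>x \<triangleleft> y; y \<triangleleft> z; x \<in> carrier G; y \<in> carrier G; z \<in> carrier G\<rbrakk> \<Longrightarrow> x \<triangleleft> z"
    and total: "\<lbrakk>x \<in> carrier G; y \<in> carrier G\<rbrakk> \<Longrightarrow> x \<triangleleft> y \<or> x = y \<or> y \<triangleleft> x"
    and mult_left: "\<lbrakk>x \<triangleleft> y; x \<in> carrier G; y \<in> carrier G; z \<in> carrier G\<rbrakk> \<Longrightarrow> z \<otimes> x \<triangleleft> z \<otimes> y"
    and mult_right: "\<lbrakk>x \<triangleleft> y; x \<in> carrier G; y \<in> carrier G; z \<in> carrier G\<rbrakk> \<Longrightarrow> x \<otimes> z \<triangleleft> y \<otimes> z"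
begin

abbreviation le (infix "\<trianglelefteq>" 50) where "x \<trianglelefteq> y \<equiv> x \<triangleleft> y \<or> x = y"

lemma less_le_trans:
  "\<lbrakk>x \<triangleleft> y; y \<trianglelefteq> z; x \<in> carrier G; y \<in> carrier G; z \<in> carrier G\<rbrakk> \<Longrightarrow> x \<triangleleft> z"
  using trans by blast

lemma mult_mono_le:
  assumes "x \<trianglelefteq> y" "u \<trianglelefteq> v" "x \<in> carrier G" "y \<in> carrier G" "u \<in> carrier G" "v \<in> carrier G"
  shows "x \<otimes> u \<trianglelefteq> y \<otimes> v"
proof -
  have "x \<otimes> u \<trianglelefteq> y \<otimes> u" using assms mult_right by blast
  moreover have "y \<otimes> u \<trianglelefteq> y \<otimes> v" using assms mult_left by blast
  ultimately show ?thesis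
    using assms(3-6) trans[of "x \<otimes> u" "y \<otimes> u" "y \<otimes> v"] by auto
qed

lemma mult_mono_less:
  assumes "x \<triangleleft> y" "u \<triangleleft> v" "x \<in> carrier G" "y \<in> carrier G" "u \<in> carrier G" "v \<in> carrier G"
  shows "x \<otimes> u \<triangleleft> y \<otimes> v"
  using trans[OF mult_right[OF assms(1,3,4,5)] mult_left[OF assms(2,5,6,4)]] assms(3-6) by simp

lemma pow_mono_less:
  assumes "x \<triangleleft> y" "x \<in> carrier G" "y \<in> carrier G" "0 < (n::nat)"
  shows "x [^] n \<triangleleft> y [^] n"
  using assms(4)
proof (induction n)
  case (Suc n)
  then show ?case
    using assms by (cases "n = 0") (auto intro: mult_mono_less)
qed simp

lemma pow_between:
  assumes e: "e \<in> carrier G" "\<one> \<triangleleft> e" and x: "x \<in> carrier G" "\<one> \<triangleleft> x"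
    and arch: "x \<triangleleft> e [^] (n::nat)"
  obtains m :: nat where "e [^] m \<trianglelefteq> x" "x \<triangleleft> e [^] Suc m"
proof -
  define k where "k = (LEAST k::nat. x \<triangleleft> e [^] k)"
  have k: "x \<triangleleft> e [^] k" unfolding k_def using arch by (rule LeastI)
  have "k \<noteq> 0" using k x trans[OF x(2)] irrefl[of "\<one>"] by (cases k) auto
  then obtain m where m: "k = Suc m" using not0_implies_Suc by blast
  have "\<not> x \<triangleleft> e [^] m" using not_less_Least[of m "\<lambda>k. x \<triangleleft> e [^] k"] m k_def by auto
  then show ?thesis using that[of m] k m total[of x "e [^] m"] e x by auto
qed

text \<open>Hoelder's argument. Let \<open>c\<close> be the positive commutator with
  \<open>c b a = a b\<close>. If \<open>e e\<close> is at most \<open>c\<close> for some positive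
  \<open>e\<close>, enclosing \<open>a\<close> and \<open>b\<close> between consecutive powers of
  \<open>e\<close> gives \<open>a b < e e (e^n e^m)\<close>, which is at most
  \<open>c b a = a b\<close>: absurd. Otherwise \<open>c\<close> is the least positive element, and
  \<open>a\<close> and \<open>b\<close> are powers of it.\<close>

lemma archimedean_commute_pos:
  assumes arch: "\<And>x y. \<lbrakk>x \<in> carrier G; y \<in> carrier G; \<one> \<triangleleft> x; \<one> \<triangleleft> y\<rbrakk> \<Longrightarrow> \<exists>n::nat. y \<triangleleft> x [^] n"
    and a: "a \<in> carrier G" "\<one> \<triangleleft> a" and b: "b \<in> carrier G" "\<one> \<triangleleft> b"
  shows "\<not> b \<otimes> a \<triangleleft> a \<otimes> b"
proof
  assume lt: "b \<otimes> a \<triangleleft> a \<otimes> b"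
  define c where "c = a \<otimes> b \<otimes> inv (b \<otimes> a)"
  have c: "c \<in> carrier G" using a b by (simp add: c_def)
  have c1: "\<one> \<triangleleft> c"
    using mult_right[OF lt, of "inv (b \<otimes> a)"] a b by (simp add: c_def)
  have cba: "c \<otimes> (b \<otimes> a) = a \<otimes> b"
    using a b by (simp add: c_def m_assoc)
  show False
  proof (cases "\<exists>d\<in>carrier G. \<one> \<triangleleft> d \<and> d \<triangleleft> c")
    case True
    then obtain d where d: "d \<in> carrier G" "\<one> \<triangleleft> d" "d \<triangleleft> c" by blast
    \<comment> \<open>Halving \<open>c\<close>: either \<open>d\<close> itself serves, or
      \<open>c < d d\<close>; then the complementary factor \<open>e\<close> with
      \<open>e d = c\<close> lies below \<open>d\<close>, so \<open>e e < e d = c\<close>.\<close>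
    have "\<exists>e\<in>carrier G. \<one> \<triangleleft> e \<and> e \<otimes> e \<trianglelefteq> c"
    proof (cases "d \<otimes> d \<trianglelefteq> c")
      case False
      define e where "e = c \<otimes> inv d"
      have e: "e \<in> carrier G" using c d by (simp add: e_def)
      have ed: "e \<otimes> d = c" using c d by (simp add: e_def m_assoc)
      have "\<one> \<triangleleft> e" using mult_right[OF d(3), of "inv d"] c d by (simp add: e_def)
      moreover have "c \<triangleleft> d \<otimes> d" using False total[of "d \<otimes> d" c] c d by auto
      then have "e \<triangleleft> d" using mult_right[of c "d \<otimes> d" "inv d"] c d by (simp add: e_def m_assoc)
      then have "e \<otimes> e \<triangleleft> e \<otimes> d" using mult_left e d by blast
      ultimately show ?thesis using e ed by auto
    qed (use d in blast)
    then obtain e where e: "e \<in> carrier G" "\<one> \<triangleleft> e" "e \<otimes> e \<trianglelefteq> c" by blast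
    obtain m :: nat where m: "e [^] m \<trianglelefteq> a" "a \<triangleleft> e [^] Suc m"
      using arch[OF e(1) a(1) e(2) a(2)] pow_between[OF e(1,2) a] by blast
    obtain n :: nat where n: "e [^] n \<trianglelefteq> b" "b \<triangleleft> e [^] Suc n"
      using arch[OF e(1) b(1) e(2) b(2)] pow_between[OF e(1,2) b] by blast
    have "a \<otimes> b \<triangleleft> e [^] Suc m \<otimes> e [^] Suc n"
      using mult_mono_less[OF m(2) n(2)] a b e by blast
    also have "e [^] Suc m \<otimes> e [^] Suc n = e [^] (2 + (n + m))"
      using nat_pow_mult[OF e(1), of "Suc m" "Suc n"] by (metis add.commute add_Suc add_Suc_right add_2_eq_Suc)
    also have "\<dots> = (e \<otimes> e) \<otimes> (e [^] n \<otimes> e [^] m)"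
      using e(1) by (simp only: nat_pow_mult[symmetric] m_closed nat_pow_closed numeral_2_eq_2 nat_pow_Suc nat_pow_0 l_one)
    finally have 1: "a \<otimes> b \<triangleleft> (e \<otimes> e) \<otimes> (e [^] n \<otimes> e [^] m)" .
    have "(e \<otimes> e) \<otimes> (e [^] n \<otimes> e [^] m) \<trianglelefteq> c \<otimes> (b \<otimes> a)"
      using mult_mono_le[OF e(3) mult_mono_le[OF n(1) m(1)]] a b c e by blast
    then have "a \<otimes> b \<triangleleft> a \<otimes> b"
      using less_le_trans[OF 1] cba a b e c by simp
    then show False using irrefl a b by blast
  next
    case False
    \<comment> \<open>Nothing lies strictly between the unit and \<open>c\<close>, so the remainder
      of \<open>x\<close> after the largest power of \<open>c\<close> not above it is
      trivial.\<close>
    have power: "\<exists>m::nat. x = c [^] m" if x: "x \<in> carrier G" "\<one> \<triangleleft> x" for x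
    proof -
      obtain m :: nat where m: "c [^] m \<trianglelefteq> x" "x \<triangleleft> c [^] Suc m"
        using arch[OF c x(1) c1 x(2)] pow_between[OF c c1 x] by blast
      have "x = c [^] m"
      proof (rule ccontr)
        assume "x \<noteq> c [^] m"
        then have "c [^] m \<triangleleft> x" using m by blast
        then have "\<one> \<triangleleft> inv (c [^] m) \<otimes> x"
          using mult_left[of "c [^] m" x "inv (c [^] m)"] c x by simp
        moreover have "inv (c [^] m) \<otimes> x \<triangleleft> c"
          using mult_left[OF m(2), of "inv (c [^] m)"] c x by (simp add: m_assoc[symmetric])
        ultimately show False using False c x by auto
      qed
      then show ?thesis by blast
    qed
    obtain m n :: nat where "a = c [^] m" "b = c [^] n" using power[OF a] power[OF b] by blast
    then have "a \<otimes> b = b \<otimes> a" using c by (simp add: nat_pow_mult add.commute)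
    then show False using lt irrefl[of "a \<otimes> b"] a b by simp
  qed
qed

theorem archimedean_commute:
  assumes arch: "\<And>x y. \<lbrakk>x \<in> carrier G; y \<in> carrier G; \<one> \<triangleleft> x; \<one> \<triangleleft> y\<rbrakk> \<Longrightarrow> \<exists>n::nat. y \<triangleleft> x [^] n"
    and "a \<in> carrier G" "\<one> \<triangleleft> a" "b \<in> carrier G" "\<one> \<triangleleft> b"
  shows "a \<otimes> b = b \<otimes> a"
  using archimedean_commute_pos[OF arch assms(2,3,4,5)] archimedean_commute_pos[OF arch assms(4,5,2,3)]
    total[of "a \<otimes> b" "b \<otimes> a"] assms(2,4) by auto

end

section \<open>Groups of hyperbolic lifts of circle homeomorphisms\<close>

text \<open>HOL-Algebra reserves the token inv for group inverses, hence no plain inv for functions.\<close>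

abbreviation finv :: "('a \<Rightarrow> 'a) \<Rightarrow> 'a \<Rightarrow> 'a" where
  "finv f \<equiv> inv_into UNIV f"

text \<open>On the circle, \<open>p\<close> is the attracting and \<open>q\<close> the repelling fixed point of \<open>f\<close>.\<close>

definition saddle :: "(real \<Rightarrow> real) \<Rightarrow> real \<Rightarrow> real \<Rightarrow> bool" where
  "saddle f p q \<longleftrightarrow> p < q \<and> q < p + 1 \<and> f p = p \<and> f q = q \<and>
     (\<forall>x. p < x \<and> x < q \<longrightarrow> f x < x) \<and> (\<forall>x. q < x \<and> x < p + 1 \<longrightarrow> x < f x)"

lemma saddleD:
  assumes "saddle f p q"
  shows "p < q" "q < p + 1" "f p = p" "f q = q"
    "\<And>x. \<lbrakk>p < x; x < q\<rbrakk> \<Longrightarrow> f x < x" "\<And>x. \<lbrakk>q < x; x < p + 1\<rbrakk> \<Longrightarrow> x < f x"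
  using assms unfolding saddle_def by auto

lemma saddle_fixed_iff:
  assumes "saddle f p q" "p < x" "x < p + 1"
  shows "f x = x \<longleftrightarrow> x = q"
  using saddleD[OF assms(1)] assms(2,3) by (metis less_irrefl linorder_neqE)

text \<open>A bounded orbit would increase to a limit in \<open>[x, y]\<close>, which continuity
  makes a fixed point, although every point there moves up.\<close>

lemma funpow_escapes:
  fixes f :: "real \<Rightarrow> real"
  assumes cont: "continuous_on UNIV f" and up: "\<And>z. \<lbrakk>x \<le> z; z \<le> y\<rbrakk> \<Longrightarrow> z < f z"
  shows "\<exists>n. y < (f ^^ n) x"
proof (rule ccontr)
  assume "\<nexists>n. y < (f ^^ n) x"
  then have le: "(f ^^ n) x \<le> y" for n by (simp add: not_less)
  have ge: "x \<le> (f ^^ n) x" for n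
  proof (induction n)
    case (Suc n)
    then show ?case using up[of "(f ^^ n) x"] le[of n] by simp
  qed simp
  have "incseq (\<lambda>n. (f ^^ n) x)"
    using up[OF ge le] by (intro incseq_SucI) (simp add: less_imp_le)
  then obtain L where L: "(\<lambda>n. (f ^^ n) x) \<longlonglongrightarrow> L"
    by (rule incseq_convergent[where B = y]) (use le in blast)+
  have "x \<le> L" using ge by (intro LIMSEQ_le_const[OF L]) blast
  have "L \<le> y" using le by (intro LIMSEQ_le_const2[OF L]) blast
  have "(\<lambda>n. f ((f ^^ n) x)) \<longlonglongrightarrow> f L"
    using cont L by (intro continuous_on_tendsto_compose[of UNIV f]) auto
  moreover have "(\<lambda>n. f ((f ^^ n) x)) \<longlonglongrightarrow> L"
    using LIMSEQ_Suc[OF L] by simp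
  ultimately have "f L = L" by (metis LIMSEQ_unique)
  then show False using up[of L] \<open>x \<le> L\<close> \<open>L \<le> y\<close> by simp
qed

lemma funpow_fixed: "f x = x \<Longrightarrow> (f ^^ n) x = x"
  by (induction n) auto

lemma ex_fixed_frac:
  fixes c x :: real
  obtains n :: int where "c \<le> x - of_int n" "x - of_int n < c + 1"
  using that[of "\<lfloor>x - c\<rfloor>"] by linarith

text \<open>In \<open>hyperbolic\<close> the two cases say that \<open>c\<close> is attracting or
  repelling; the repelling case is written at \<open>c + 1\<close> because \<open>saddle\<close>
  lists the attracting point first.\<close>

locale hyperbolic_lifts =
  fixes T :: "(real \<Rightarrow> real) set"
  assumes id_mem: "id \<in> T"
    and comp_mem: "\<lbrakk>f \<in> T; g \<in> T\<rbrakk> \<Longrightarrow> f \<circ> g \<in> T"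
    and ex_inv: "f \<in> T \<Longrightarrow> \<exists>g\<in>T. f \<circ> g = id \<and> g \<circ> f = id"
    and mono: "f \<in> T \<Longrightarrow> strict_mono f"
    and cont: "f \<in> T \<Longrightarrow> continuous_on UNIV f"
    and shift: "f \<in> T \<Longrightarrow> f (x + 1) = f x + 1"
    and hyperbolic: "\<lbrakk>f \<in> T; f \<noteq> id; f c = c\<rbrakk> \<Longrightarrow> \<exists>d. saddle f c d \<or> saddle f d (c + 1)"
begin

lemma less_iff: "f \<in> T \<Longrightarrow> f x < f y \<longleftrightarrow> x < y"
  using mono strict_mono_less by blast

lemma le_iff: "f \<in> T \<Longrightarrow> f x \<le> f y \<longleftrightarrow> x \<le> y"
  using mono strict_mono_less_eq by blast

lemma inv_props:
  assumes "f \<in> T"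
  shows "finv f \<in> T" "f (finv f x) = x" "finv f (f x) = x" "f \<circ> finv f = id" "finv f \<circ> f = id"
proof -
  obtain g where g: "g \<in> T" "f \<circ> g = id" "g \<circ> f = id" using ex_inv assms by blast
  have eq: "finv f = g" using g by (simp add: inv_unique_comp)
  show "finv f \<in> T" "f (finv f x) = x" "finv f (f x) = x" "f \<circ> finv f = id" "finv f \<circ> f = id"
    unfolding eq using g by (auto simp: fun_eq_iff)
qed

lemma inv_fixed_iff: "f \<in> T \<Longrightarrow> finv f x = x \<longleftrightarrow> f x = x"
  using inv_props by metis

lemma inv_less_iff: "f \<in> T \<Longrightarrow> finv f x < y \<longleftrightarrow> x < f y"
  using less_iff[of f "finv f x" y] by (simp add: inv_props)

lemma less_inv_iff: "f \<in> T \<Longrightarrow> x < finv f y \<longleftrightarrow> f x < y"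
  using less_iff[of f x "finv f y"] by (simp add: inv_props)

lemma funpow_mem: "f \<in> T \<Longrightarrow> f ^^ n \<in> T"
  by (induction n) (auto simp: id_mem comp_mem)

lemma shift_int: 
  assumes "f \<in> T"
  shows "f (x + of_int n) = f x + of_int n"
proof -
  have nat: "f (y + of_nat m) = f y + of_nat m" for y m
  proof (induction m)
    case (Suc m)
    then show ?case using shift[OF assms, of "y + of_nat m"] by (simp add: algebra_simps)
  qed simp
  show ?thesis
  proof (cases "0 \<le> n")
    case True
    then show ?thesis using nat[of x "nat n"] by simp
  next
    case False
    then show ?thesis using nat[of "x + of_int n" "nat (- n)"] by simp
  qed
qed

lemma shift_int_fixed: "f \<in> T \<Longrightarrow> f (x + of_int n) = x + of_int n \<longleftrightarrow> f x = x"
  by (simp add: shift_int)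

lemma shift_minus: "f \<in> T \<Longrightarrow> f (x - 1) = f x - 1"
  using shift[of f "x - 1"] by simp

lemma saddle_invD:
  assumes "f \<in> T" "saddle (finv f) p q"
  shows "p < q" "q < p + 1" "f p = p" "f q = q"
    "\<And>x. \<lbrakk>p < x; x < q\<rbrakk> \<Longrightarrow> x < f x" "\<And>x. \<lbrakk>q < x; x < p + 1\<rbrakk> \<Longrightarrow> f x < x"
  using saddleD[OF assms(2)] assms(1) by (auto simp: inv_fixed_iff inv_less_iff less_inv_iff)

text \<open>Inversion exchanges attracting and repelling points, so a repelling \<open>c\<close> is
  attracting for the inverse.\<close>

lemma ex_saddle:
  assumes "f \<in> T" "f \<noteq> id" "f c = c"
  obtains d where "saddle f c d \<or> saddle (finv f) c d"
proof -
  obtain d where "saddle f c d \<or> saddle f d (c + 1)" using hyperbolic assms by blast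
  moreover have "saddle (finv f) c d" if s: "saddle f d (c + 1)"
  proof -
    note f = saddleD[OF s]
    have "finv f x < x" if "c < x" "x < d" for x
      using f(6)[of "x + 1"] that assms(1) by (simp add: inv_less_iff shift)
    moreover have "x < finv f x" if "d < x" "x < c + 1" for x
      using f(5)[of x] that assms(1) by (simp add: less_inv_iff)
    ultimately show ?thesis
      using f assms unfolding saddle_def by (auto simp: inv_fixed_iff)
  qed
  ultimately show ?thesis using that by blast
qed

section \<open>The stabiliser of a point as a bi-ordered group of germs\<close>

definition stab :: "real \<Rightarrow> (real \<Rightarrow> real) set" where
  "stab c = {f \<in> T. f c = c}"

text \<open>Germs are compared on the left of \<open>c + 1\<close>. There a nontrivial element of
  \<open>stab c\<close> has a constant sign relative to \<open>id\<close>: above it if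
  \<open>c\<close> is attracting, below it if \<open>c\<close> is repelling.\<close>

definition less_near :: "real \<Rightarrow> (real \<Rightarrow> real) \<Rightarrow> (real \<Rightarrow> real) \<Rightarrow> bool" where
  "less_near c f g \<longleftrightarrow> (\<forall>\<^sub>F x in at_left (c + 1). f x < g x)"

definition stab_group :: "real \<Rightarrow> (real \<Rightarrow> real) monoid" where
  "stab_group c = \<lparr>carrier = stab c, mult = (\<circ>), one = id\<rparr>"

lemma stab_inv: "f \<in> stab c \<Longrightarrow> finv f \<in> stab c"
  by (simp add: stab_def inv_props(1) inv_fixed_iff)

lemma stab_comp: "\<lbrakk>f \<in> stab c; g \<in> stab c\<rbrakk> \<Longrightarrow> f \<circ> g \<in> stab c"
  by (simp add: stab_def comp_mem)

lemma group_stab_group: "group (stab_group c)"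
proof (rule groupI)
  fix f assume "f \<in> carrier (stab_group c)"
  then show "\<exists>g\<in>carrier (stab_group c). g \<otimes>\<^bsub>stab_group c\<^esub> f = \<one>\<^bsub>stab_group c\<^esub>"
    using stab_inv[of f c] inv_props(5)[of f] by (auto simp: stab_group_def stab_def)
qed (auto simp: stab_group_def stab_comp comp_assoc stab_def id_mem comp_mem)

lemma pow_stab_group: "f [^]\<^bsub>stab_group c\<^esub> (n::nat) = f ^^ n"
  by (induction n) (simp_all add: nat_pow_def stab_group_def funpow_Suc_right del: funpow.simps(2))

lemma saddle_less_near:
  assumes "saddle f c d"
  shows "less_near c id f"
  unfolding less_near_def using saddleD[OF assms]
  by (intro eventually_at_leftI[of d]) auto

lemma saddle_inv_less_near:
  assumes "f \<in> T" "saddle (finv f) c d"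
  shows "less_near c f id"
  unfolding less_near_def using saddle_invD[OF assms]
  by (intro eventually_at_leftI[of d]) auto

lemma less_near_irrefl: "\<not> less_near c f f"
  by (simp add: less_near_def)

lemma less_near_trans: "\<lbrakk>less_near c f g; less_near c g h\<rbrakk> \<Longrightarrow> less_near c f h"
  unfolding less_near_def by (auto elim: eventually_elim2)

lemma less_near_comp_left:
  "\<lbrakk>less_near c f g; h \<in> T\<rbrakk> \<Longrightarrow> less_near c (h \<circ> f) (h \<circ> g)"
  unfolding less_near_def by (auto elim: eventually_mono simp: less_iff)

text \<open>Since \<open>h\<close> is continuous, increasing and fixes \<open>c + 1\<close>, it
  tends to \<open>c + 1\<close> from the left, and the inequality may be evaluated along
  \<open>h\<close>.\<close>

lemma less_near_comp_right:
  assumes "less_near c f g" "h \<in> stab c"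
  shows "less_near c (f \<circ> h) (g \<circ> h)"
proof -
  have h: "h \<in> T" "h (c + 1) = c + 1" using assms(2) by (auto simp: stab_def shift)
  have "(h \<longlongrightarrow> c + 1) (at_left (c + 1))"
    using continuous_on_tendsto_compose[OF cont[OF h(1)] tendsto_ident_at, of "c + 1"] h by simp
  moreover have "\<forall>\<^sub>F x in at_left (c + 1). h x \<in> {..<c + 1} \<and> h x \<noteq> c + 1"
  proof (rule eventually_at_leftI[of c])
    fix x assume "x \<in> {c<..<c + 1}"
    then have "h x < h (c + 1)" using less_iff[OF h(1)] by simp
    then show "h x \<in> {..<c + 1} \<and> h x \<noteq> c + 1" using h(2) by simp
  qed simp
  ultimately have "filterlim h (at_left (c + 1)) (at_left (c + 1))"
    by (simp add: filterlim_at)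
  then show ?thesis
    using assms(1) unfolding less_near_def by (auto dest: eventually_compose_filterlim)
qed

lemma less_near_cases:
  assumes "f \<in> stab c" "f \<noteq> id"
  obtains d where "saddle f c d" "less_near c id f" | d where "saddle (finv f) c d" "less_near c f id"
proof -
  have f: "f \<in> T" "f c = c" using assms by (auto simp: stab_def)
  obtain d where "saddle f c d \<or> saddle (finv f) c d" using ex_saddle[OF f(1) assms(2) f(2)] .
  then show ?thesis
    using that saddle_less_near[of f c d] saddle_inv_less_near[OF f(1), of c d] by blast
qed

lemma less_near_id_saddle:
  assumes "f \<in> stab c"
  shows "less_near c id f \<Longrightarrow> \<exists>d. saddle f c d" "less_near c f id \<Longrightarrow> \<exists>d. saddle (finv f) c d"
proof -
  show "\<exists>d. saddle f c d" if "less_near c id f"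
    using less_near_cases[OF assms] that less_near_irrefl less_near_trans[of c id f id] by metis
  show "\<exists>d. saddle (finv f) c d" if "less_near c f id"
    using less_near_cases[OF assms] that less_near_irrefl less_near_trans[of c f id f] by metis
qed

text \<open>By left invariance it suffices to compare \<open>finv f \<circ> g\<close> with
  \<open>id\<close>, and a nontrivial element has a definite sign near \<open>c + 1\<close>.\<close>

lemma less_near_total:
  assumes "f \<in> stab c" "g \<in> stab c"
  shows "less_near c f g \<or> f = g \<or> less_near c g f"
proof -
  have T: "f \<in> T" "g \<in> T" using assms by (auto simp: stab_def)
  let ?u = "finv f \<circ> g"
  have u: "?u \<in> stab c" "f \<circ> ?u = g"
    using assms T by (auto simp: stab_inv stab_comp fun_eq_iff inv_props)
  consider "?u = id" | "less_near c id ?u" | "less_near c ?u id"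
    using less_near_cases[OF u(1)] by blast
  then show ?thesis
  proof cases
    case 1
    then show ?thesis using u by (metis comp_id)
  next
    case 2
    then show ?thesis using less_near_comp_left[OF 2 T(1)] u by simp
  next
    case 3
    then show ?thesis using less_near_comp_left[OF 3 T(1)] u by simp
  qed
qed

lemma biordered_stab_group: "biordered_group (stab_group c) (less_near c)"
proof -
  interpret group "stab_group c" by (rule group_stab_group)
  show ?thesis
  proof
    fix x y assume "x \<in> carrier (stab_group c)" "y \<in> carrier (stab_group c)"
    then show "less_near c x y \<or> x = y \<or> less_near c y x"
      by (simp add: stab_group_def less_near_total)
  next
    fix x y z assume "less_near c x y" "less_near c y z"
    then show "less_near c x z" by (rule less_near_trans)
  next
    fix x y z assume "less_near c x y" "z \<in> carrier (stab_group c)"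
    then show "less_near c (z \<otimes>\<^bsub>stab_group c\<^esub> x) (z \<otimes>\<^bsub>stab_group c\<^esub> y)"
      and "less_near c (x \<otimes>\<^bsub>stab_group c\<^esub> z) (y \<otimes>\<^bsub>stab_group c\<^esub> z)"
      by (simp_all add: stab_group_def stab_def less_near_comp_left less_near_comp_right)
  qed (simp add: less_near_irrefl)
qed

text \<open>The quotient \<open>finv k \<circ> f\<close> has a single fixed point \<open>d\<close>
  in \<open>(c, c + 1)\<close>, moves points up before \<open>d\<close> and down after it. So the
  two graphs cross once, with \<open>f\<close> above \<open>k\<close> to the left of
  \<open>d\<close> and below it to the right.\<close>

lemma less_near_crossing:
  assumes f: "f \<in> stab c" and k: "k \<in> stab c" and less: "less_near c f k"
    and x: "c < x" "x < c + 1" "f x < k x" and y: "c < y" "y < c + 1" "k y < f y"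
  shows "y < x"
proof -
  have T: "f \<in> T" "k \<in> T" using f k by (auto simp: stab_def)
  let ?u = "finv k \<circ> f"
  have u: "?u \<in> stab c" using f k by (simp add: stab_inv stab_comp)
  have "less_near c ?u id"
    using less_near_comp_left[OF less, of "finv k"] T by (simp add: inv_props)
  then obtain d where d: "saddle (finv ?u) c d"
    using less_near_id_saddle(2)[OF u] by blast
  have uT: "?u \<in> T" using u by (simp add: stab_def)
  note D = saddle_invD[OF uT d]
  have "?u x < x" "y < ?u y" using x y T by (auto simp: inv_less_iff less_inv_iff)
  then have "d < x" "y < d"
    using D(5)[of x] D(6)[of y] D(4) x y by (metis less_asym linorder_neqE less_irrefl)+
  then show ?thesis by simp
qed

text \<open>If every power of \<open>f\<close> stayed below \<open>k\<close> near \<open>c + 1\<close>, the graphs of some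
  \<open>f ^^ n\<close> and \<open>k\<close> would cross twice over \<open>(c, c + 1)\<close>, but \<open>finv k \<circ> f ^^ n\<close> has only one fixed point there.\<close>

lemma less_near_funpow_neq:
  assumes f: "f \<in> T" "saddle f c p" and k: "k \<in> T" "saddle k c q" and neq: "p \<noteq> q"
  shows "\<exists>n. less_near c k (f ^^ n)"
proof (rule ccontr)
  assume none: "\<nexists>n. less_near c k (f ^^ n)"
  note F = saddleD[OF f(2)] and K = saddleD[OF k(2)]
  have fn: "f ^^ n \<in> stab c" for n using F funpow_mem f by (simp add: stab_def funpow_fixed)
  have ks: "k \<in> stab c" using k K by (simp add: stab_def)
  have less: "less_near c (f ^^ n) k" for n
  proof -
    have "k p \<noteq> (f ^^ n) p" 
      using saddle_fixed_iff[OF k(2), of p] F neq by (simp add: funpow_fixed)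
    then have "k \<noteq> f ^^ n" by auto
    then show ?thesis using none less_near_total[OF ks fn] by blast
  qed
  show False
  proof (cases "q < p")
    case True
    \<comment> \<open>Iterates of \<open>f\<close> push \<open>y\<close> above \<open>k y\<close>,
      since \<open>c + 1\<close> attracts, while at \<open>p < y\<close> they stay at
      \<open>p < k p\<close>. This is the wrong order for a crossing.\<close>
    obtain y where y: "p < y" "y < c + 1" using F dense by blast
    have "k y < c + 1" using less_iff[OF k(1), of y "c + 1"] y K shift[OF k(1), of c] by simp
    then obtain n where "k y < (f ^^ n) y"
      using funpow_escapes[OF cont[OF f(1)], of y "k y"] F y by auto
    moreover have "(f ^^ n) p < k p"
      using F K True by (simp add: funpow_fixed)
    ultimately show False
      using less_near_crossing[OF fn ks less, where x = p and y = y] F y by auto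
  next
    case False
    \<comment> \<open>Mirror case \<open>p < q\<close>: iterates of \<open>f\<close> bring
      \<open>x\<close> below \<open>k x\<close>, seen through the inverse iterates lifting
      \<open>k x\<close> above \<open>x\<close>, while at \<open>p > x\<close> they stay at
      \<open>p > k p\<close>.\<close>
    obtain x where x: "c < x" "x < p" using F dense by blast
    have kx: "c < k x" "k x < p"
      using less_iff[OF k(1), of c x] K(5)[of x] K(3) False neq x by auto
    have "x < finv f x" if "c < x" "x < p" for x
      using F that f by (simp add: less_inv_iff)
    then obtain n where "x < (finv f ^^ n) (k x)"
      using funpow_escapes[OF cont[OF inv_props(1)[OF f(1)]], of "k x" x] kx x by auto
    moreover have "(f ^^ n) ((finv f ^^ n) z) = z" for z
      using f by (induction n arbitrary: z) (auto simp: inv_props funpow_swap1)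
    ultimately have "(f ^^ n) x < k x"
      using less_iff[OF fn[unfolded stab_def, simplified, THEN conjunct1]] by metis
    moreover have "k p < (f ^^ n) p"
      using F K False neq by (simp add: funpow_fixed)
    ultimately show False
      using less_near_crossing[OF fn ks less, where x = x and y = p] F x by auto
  qed
qed

text \<open>Different repelling points make the order on the stabiliser Archimedean: powers of a
  positive element overtake every positive element with another repelling point, and those with the
  same one by way of \<open>f\<close> or \<open>k\<close>. Hoelder's theorem then applies.\<close>

lemma saddle_commute_neq:
  assumes f: "f \<in> T" "saddle f c p" and k: "k \<in> T" "saddle k c q" and neq: "p \<noteq> q"
  shows "f \<circ> k = k \<circ> f"
proof -
  interpret biordered_group "stab_group c" "less_near c" by (rule biordered_stab_group)
  have arch: "\<exists>n. less_near c y (x ^^ n)"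
    if xy: "x \<in> stab c" "y \<in> stab c" "less_near c id x" "less_near c id y" for x y
  proof -
    obtain a b where a: "saddle x c a" and b: "saddle y c b"
      using less_near_id_saddle(1) xy by metis
    have T: "x \<in> T" "y \<in> T" using xy by (auto simp: stab_def)
    show ?thesis
    proof (cases "a = b")
      case True
      \<comment> \<open>\<open>j\<close> is whichever of \<open>f\<close> and \<open>k\<close> has a
        repelling point other than \<open>a\<close>. It links \<open>x\<close> to \<open>y\<close>
        by \<open>y < j^n < (x^m)^n\<close>, with \<open>n\<close> nonzero because \<open>y\<close>
        is positive.\<close>
      obtain j r where j: "j \<in> T" "saddle j c r" "r \<noteq> a" using f k neq by metis
      obtain m where m: "less_near c j (x ^^ m)"
        using less_near_funpow_neq[OF T(1) a j(1,2)] j(3) by blast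
      obtain n where n: "less_near c y (j ^^ n)"
        using less_near_funpow_neq[OF j(1,2) T(2) b] j(3) True by blast
      have "n \<noteq> 0"
        using n xy(4) less_near_trans[of c id y id] less_near_irrefl by (cases n) (auto simp: id_def)
      then have "less_near c (j ^^ n) ((x ^^ m) ^^ n)"
        using pow_mono_less[OF m, of n] j saddleD[OF j(2)] xy(1) funpow_mem
        unfolding pow_stab_group by (simp add: stab_group_def stab_def funpow_fixed)
      then show ?thesis using n less_near_trans by (metis funpow_mult)
    qed (use less_near_funpow_neq[OF T(1) a T(2) b] in blast)
  qed
  have "f \<otimes>\<^bsub>stab_group c\<^esub> k = k \<otimes>\<^bsub>stab_group c\<^esub> f"
  proof (rule archimedean_commute)
    show "\<exists>n::nat. less_near c y (x [^]\<^bsub>stab_group c\<^esub> n)"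
      if "x \<in> carrier (stab_group c)" "y \<in> carrier (stab_group c)"
        "less_near c \<one>\<^bsub>stab_group c\<^esub> x" "less_near c \<one>\<^bsub>stab_group c\<^esub> y" for x y
      using arch that unfolding pow_stab_group by (simp add: stab_group_def)
  qed (use f k saddleD(3)[OF f(2)] saddleD(3)[OF k(2)] in
      \<open>simp_all add: stab_group_def stab_def saddle_less_near\<close>)
  then show ?thesis by (simp add: stab_group_def)
qed

text \<open>If the points differed, \<open>f\<close> and \<open>k\<close> would commute, so
  \<open>k\<close> would permute the fixed points of \<open>f\<close>. As \<open>k p\<close> stays
  in \<open>(c, c + 1)\<close>, it would equal \<open>p\<close>, making \<open>p\<close> the fixed
  point \<open>q\<close> of \<open>k\<close>.\<close>

lemma saddle_unique:
  assumes f: "f \<in> T" "saddle f c p" and k: "k \<in> T" "saddle k c q"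
  shows "p = q"
proof (rule ccontr)
  assume neq: "p \<noteq> q"
  note F = saddleD[OF f(2)] and K = saddleD[OF k(2)]
  have "f (k p) = k (f p)" using saddle_commute_neq[OF f k neq] by (metis comp_apply)
  then have "f (k p) = k p" using F by simp
  moreover have "c < k p" "k p < c + 1"
    using less_iff[OF k(1), of c p] less_iff[OF k(1), of p "c + 1"] F K shift[OF k(1), of c] by auto
  ultimately have "k p = p" using saddle_fixed_iff[OF f(2)] by simp
  then show False using saddle_fixed_iff[OF k(2)] F neq by simp
qed

text \<open>Up to inversion, \<open>c\<close> is attracting for both maps, so their repelling points
  in \<open>(c, c + 1)\<close> agree; integer translation carries this to the whole line.\<close>

lemma fixed_transfer:
  assumes f: "f \<in> T" "f \<noteq> id" and k: "k \<in> T" "k \<noteq> id" and c: "f c = c" "k c = c"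
    and x: "f x = x"
  shows "k x = x"
proof -
  obtain n where n: "c \<le> x - of_int n" "x - of_int n < c + 1" using ex_fixed_frac .
  define y where "y = x - of_int n"
  have xy: "x = y + of_int n" by (simp add: y_def)
  have fy: "f y = y" using x f shift_int_fixed xy by blast
  have "k y = y"
  proof (cases "y = c")
    case False
    then have y: "c < y" "y < c + 1" using n y_def by auto
    obtain f' d where f': "f' \<in> T" "saddle f' c d" "f' y = y"
      using ex_saddle[OF f c(1)] inv_props(1)[OF f(1)] inv_fixed_iff[OF f(1)] f fy by metis
    obtain k' e where k': "k' \<in> T" "saddle k' c e" "k' y = y \<longleftrightarrow> k y = y"
      using ex_saddle[OF k c(2)] inv_props(1)[OF k(1)] inv_fixed_iff[OF k(1)] k by metis
    have "d = e" using saddle_unique f' k' by blast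
    then show ?thesis
      using saddle_fixed_iff[OF f'(2) y] saddle_fixed_iff[OF k'(2) y] f' k' by simp
  qed (use c in simp)
  then show ?thesis using k shift_int_fixed xy by blast
qed

section \<open>Ping-pong and maps that move every point up\<close>

lemma saddle_funpow_above:
  assumes f: "f \<in> T" "saddle f p q" and x: "q < x" "x < p + 1" and n: "0 < n"
  shows "x < (f ^^ n) x"
proof -
  note F = saddleD[OF f(2)]
  have "x \<le> (f ^^ n) x \<and> (f ^^ n) x < p + 1 \<and> (0 < n \<longrightarrow> x < (f ^^ n) x)" for n
  proof (induction n)
    case (Suc n)
    have "f ((f ^^ n) x) < f (p + 1)" using Suc less_iff[OF f(1)] by simp
    moreover have "(f ^^ n) x < f ((f ^^ n) x)" using F(6)[of "(f ^^ n) x"] Suc x by simp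
    ultimately show ?case using Suc F(3) shift[OF f(1), of p] by simp
  qed (use x in simp)
  then show ?thesis using n by blast
qed

text \<open>Over one period \<open>f\<close> moves points down only between \<open>p + 1\<close> and
  \<open>q + 1\<close>, and \<open>k\<close> only between \<open>u\<close> and \<open>v\<close>. A
  high power of \<open>k\<close> jumps over the first arc, a high power of \<open>f\<close> over the
  second, and their composite moves everything up.\<close>

lemma unlinked_saddles:
  assumes f: "f \<in> T" "saddle f p q" and k: "k \<in> T" "saddle k u v"
    and order: "q < u" "v < p + 1"
  shows "\<exists>h\<in>T. \<forall>x. x < h x"
proof -
  note F = saddleD[OF f(2)] and K = saddleD[OF k(2)]
  obtain n where n: "v < (f ^^ n) u"
    using funpow_escapes[OF cont[OF f(1)], of u v] F order by auto
  obtain m where m: "q + 1 < (k ^^ m) (p + 1)"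
    using funpow_escapes[OF cont[OF k(1)], of "p + 1" "q + 1"] F K order by auto
  have n0: "0 < n" using n K by (cases n) auto
  have m0: "0 < m" using m F by (cases m) auto
  define h where "h = f ^^ n \<circ> k ^^ m"
  have fT: "f ^^ n \<in> T" and kT: "k ^^ m \<in> T" using f k by (simp_all add: funpow_mem)
  have fp: "(f ^^ n) (p + 1) = p + 1" using F shift[OF f(1), of p] by (simp add: funpow_fixed)
  have ku: "(k ^^ m) u = u" "(k ^^ m) (u + 1) = u + 1"
    using K shift[OF k(1), of u] by (simp_all add: funpow_fixed)
  have hT: "h \<in> T" using fT kT by (simp add: h_def comp_mem)
  have base: "x < h x" if x: "u \<le> x" "x < u + 1" for x
  proof (cases "x \<le> v")
    case True
    have "(f ^^ n) u \<le> h x"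
      using le_iff[OF fT] le_iff[OF kT, of u x] x ku by (simp add: h_def)
    then show ?thesis using n True by simp
  next
    case False
    define y where "y = (k ^^ m) x"
    have y: "x < y" "y < u + 1"
      using saddle_funpow_above[OF k _ x(2) m0] less_iff[OF kT, of x "u + 1"] ku x False
      by (auto simp: y_def)
    have hx: "h x = (f ^^ n) y" by (simp add: h_def y_def)
    \<comment> \<open>Below \<open>p + 1\<close> both powers move up. If \<open>k^m\<close> carries
      \<open>x\<close> across \<open>p + 1\<close>, this fixed point of \<open>f^n\<close> separates
      \<open>x\<close> from \<open>h x\<close>. If \<open>x\<close> is already past it, the choice
      of \<open>m\<close> puts \<open>y\<close> beyond \<open>q + 1\<close>, where \<open>f\<close>
      moves up again.\<close>
    consider "y < p + 1" | "y = p + 1" | "p + 1 < y" "x \<le> p + 1" | "p + 1 < x" by linarith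
    then show ?thesis
    proof cases
      case 1
      then show ?thesis
        using saddle_funpow_above[OF f _ 1 n0] y False K order hx by simp
    next
      case 2
      then show ?thesis using fp y hx by simp
    next
      case 3
      then show ?thesis using less_iff[OF fT, of "p + 1" y] fp hx by simp
    next
      case 4
      then have "q + 1 < y" using m less_iff[OF kT, of "p + 1" x] by (simp add: y_def)
      then have "y - 1 < (f ^^ n) (y - 1)"
        using saddle_funpow_above[OF f _ _ n0, of "y - 1"] y order F K by simp
      then show ?thesis using y hx shift_minus[OF fT, of y] by simp
    qed
  qed
  have "x < h x" for x
  proof -
    obtain i where i: "u \<le> x - of_int i" "x - of_int i < u + 1" using ex_fixed_frac .
    show ?thesis using base[OF i] shift_int[OF hT, of "x - of_int i" i] by simp
  qed
  then show ?thesis using hT by blast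
qed

lemma ex_saddle_at:
  assumes f: "f \<in> T" "f \<noteq> id" and p: "p < q" "q < p + 1" "f p = p" "f q = q"
  obtains f' where "f' \<in> T" "saddle f' p q"
proof -
  obtain d where d: "saddle f p d \<or> saddle (finv f) p d" using ex_saddle f p by blast
  then have "d = q"
    using saddle_fixed_iff[of f p d q] saddle_fixed_iff[of "finv f" p d q] p inv_fixed_iff[OF f(1)]
    by metis
  then show ?thesis using that d f inv_props(1) by blast
qed

text \<open>Directions do not matter: replacing \<open>f\<close> or \<open>k\<close> by its inverse
  makes \<open>p\<close> and \<open>u\<close> attracting.\<close>

lemma unlinked_free:
  assumes f: "f \<in> T" "f \<noteq> id" "f p = p" "f q = q" and k: "k \<in> T" "k \<noteq> id" "k u = u" "k v = v"
    and order: "p < q" "q < u" "u < v" "v < p + 1"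
  shows "\<exists>h\<in>T. \<forall>x. x < h x"
proof -
  obtain f' where f': "f' \<in> T" "saddle f' p q" using ex_saddle_at[OF f(1,2), of p q] f order by auto
  obtain k' where k': "k' \<in> T" "saddle k' u v" using ex_saddle_at[OF k(1,2), of u v] k order by auto
  show ?thesis using unlinked_saddles[OF f' k' order(2,4)] .
qed

text \<open>Conjugating \<open>f\<close> by \<open>k\<close> moves both of its fixed points towards the attracting point \<open>v\<close>
  of \<open>k\<close>, one from each side, so \<open>f\<close> and its conjugate are unlinked.\<close>

lemma linked_free:
  assumes f: "f \<in> T" "f \<noteq> id" "f p = p" "f q = q" and k: "k \<in> T" "saddle (finv k) u v"
    and order: "u < p" "p < v" "v < q" "q < u + 1"
  shows "\<exists>h\<in>T. \<forall>x. x < h x"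
proof -
  note K = saddle_invD[OF k]
  let ?g = "k \<circ> (f \<circ> finv k)"
  have g: "?g \<in> T" "?g (k p) = k p" "?g (k q) = k q"
    using f k by (simp_all add: comp_mem inv_props)
  have "?g \<noteq> id"
  proof
    assume "?g = id"
    then have "?g (k x) = k x" for x by simp
    then have "k (f x) = k x" for x using k by (simp add: inv_props)
    then have "f x = x" for x using k inv_props(3) by metis
    then show False using f(2) by (auto simp: fun_eq_iff)
  qed
  moreover have "p < k p" "k q < q" using K order by auto
  moreover have "k p < k q" using less_iff[OF k(1)] order by simp
  moreover have "f (p + 1) = p + 1" using f shift[OF f(1)] by simp
  ultimately show ?thesis
    using unlinked_free[of ?g "k p" "k q" f q "p + 1"] f g order by auto
qed

text \<open>The second fixed point \<open>d\<close> of \<open>k\<close> in \<open>(e, e + 1)\<close>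
  decides. Before \<open>p + 1\<close> or after \<open>q + 1\<close> the pairs are unlinked, with
  \<open>d - 1\<close> and \<open>e\<close> as the pair of \<open>k\<close> in the latter case. In
  between they are linked, and inverting \<open>k\<close> if necessary makes \<open>e\<close>
  repelling.\<close>

lemma fixed_between_free:
  assumes f: "f \<in> T" "f \<noteq> id" "f p = p" "f q = q" and k: "k \<in> T" "k \<noteq> id" "k e = e"
    and order: "p < q" "q < e" "e < p + 1"
    and disj: "\<And>x. f x = x \<Longrightarrow> k x \<noteq> x"
  shows "\<exists>h\<in>T. \<forall>x. x < h x"
proof -
  obtain d where d: "saddle k e d \<or> saddle (finv k) e d" using ex_saddle k by blast
  then have d': "e < d" "d < e + 1" "k d = d"
    using saddleD[of k e d] saddle_invD[OF k(1), of e d] by auto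
  have f1: "f (p + 1) = p + 1" "f (q + 1) = q + 1" using f shift[OF f(1)] by auto
  have "d \<noteq> p + 1" "d \<noteq> q + 1" using f1 disj d' by blast+
  then consider "d < p + 1" | "q + 1 < d" | "p + 1 < d" "d < q + 1" by linarith
  then show ?thesis
  proof cases
    case 1
    then show ?thesis using unlinked_free[of f p q k e d] f k d' order by simp
  next
    case 2
    then show ?thesis
      using unlinked_free[of f p q k "d - 1" e] f k d' order shift_minus[OF k(1), of d] by simp
  next
    case 3
    obtain k' where "k' \<in> T" "saddle (finv k') e d"
    proof (cases "saddle k e d")
      case True
      moreover have "finv (finv k) = k" using inv_props[OF k(1)] by (metis inv_unique_comp)
      ultimately show ?thesis using that[of "finv k"] inv_props(1)[OF k(1)] by simp
    qed (use that d k in blast)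
    then show ?thesis
      using linked_free[of f "p + 1" "q + 1" k' e d] f f1 order 3 by simp
  qed
qed

lemma fixed_point_free_cases:
  assumes "f \<in> T" "\<And>x. f x \<noteq> x"
  shows "(\<forall>x. x < f x) \<or> (\<forall>x. f x < x)"
proof (rule ccontr)
  assume "\<not> ?thesis"
  then obtain x y where "f x \<le> x" "y \<le> f y" by (auto simp: not_less)
  moreover have "continuous_on S (\<lambda>z. f z - z)" for S
    using cont[OF assms(1)] by (intro continuous_intros) (auto intro: continuous_on_subset)
  ultimately have "\<exists>z. f z - z = 0"
    using IVT'[of "\<lambda>z. f z - z" x 0 y] IVT2'[of "\<lambda>z. f z - z" x 0 y] by (cases "x \<le> y") auto
  then show False using assms(2) by auto
qed

text \<open>A fixed point free \<open>k\<close> works up to inversion. Otherwise a common fixed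
  point would transfer to \<open>k c = c\<close>, so the fixed sets are disjoint and a fixed point
  of \<open>k\<close> lies inside an arc between consecutive fixed points of
  \<open>f\<close>.\<close>

lemma ex_free:
  assumes f: "f \<in> T" "f \<noteq> id" "f c = c" and k: "k \<in> T" "k c \<noteq> c"
  shows "\<exists>h\<in>T. \<forall>x. x < h x"
proof (cases "\<exists>e. k e = e")
  case False
  then consider "\<forall>x. x < k x" | "\<forall>x. k x < x" using fixed_point_free_cases[OF k(1)] by blast
  then show ?thesis
  proof cases
    case 2
    then have "\<forall>x. x < finv k x" using k less_inv_iff by blast
    then show ?thesis using k inv_props(1) by blast
  qed (use k in blast)
next
  case True
  then obtain e0 where e0: "k e0 = e0" by blast
  have kid: "k \<noteq> id" using k by auto
  have disj: "k x \<noteq> x" if "f x = x" for x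
    using fixed_transfer[OF f(1,2) k(1) kid] fixed_transfer[OF k(1) kid f(1,2) _ that] that
      fixed_transfer[of f k x c] f k kid by blast
  obtain d where d: "saddle f c d \<or> saddle (finv f) c d" using ex_saddle f by blast
  then have d': "c < d" "d < c + 1" "f d = d"
    using saddleD[of f c d] saddle_invD[OF f(1), of c d] by auto
  obtain i where i: "c \<le> e0 - of_int i" "e0 - of_int i < c + 1" using ex_fixed_frac .
  define e where "e = e0 - of_int i"
  have ke: "k e = e" using shift_int[OF k(1), of e0 "- i"] e0 by (simp add: e_def)
  have e: "c < e" "e < c + 1" "e \<noteq> d"
    using i disj[OF f(3)] disj[OF d'(3)] ke e_def by (auto simp: less_le)
  show ?thesis
  proof (cases "d < e")
    case True
    then show ?thesis
      using fixed_between_free[OF f(1,2,3) d'(3) k(1) kid ke d'(1) True e(2)] disj by blast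
  next
    case False
    \<comment> \<open>Here \<open>c < e < d\<close>, so \<open>d\<close> and \<open>c + 1\<close>
      serve as the pair of \<open>f\<close>, followed by the translate \<open>e + 1\<close> before
      \<open>d + 1\<close>.\<close>
    then show ?thesis
      using fixed_between_free[OF f(1,2) d'(3) _ k(1) kid, of "c + 1" "e + 1"] disj e d' f k ke
      by (auto simp: shift)
  qed
qed

text \<open>Density supplies an element with a fixed point strictly between two consecutive fixed
  points of another, hence a map that moves every point up; periodicity makes the displacement of
  some power uniformly large.\<close>

theorem ex_large_translation:
  assumes dense: "\<And>a b. a < b \<Longrightarrow> \<exists>c f. a < c \<and> c < b \<and> f \<in> T \<and> f \<noteq> id \<and> f c = c"
  shows "\<exists>h\<in>T. \<forall>x. x + 1 \<le> h x"
proof -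
  obtain p f where f: "f \<in> T" "f \<noteq> id" "f p = p" using dense[of 0 1] by auto
  obtain q where q: "saddle f p q \<or> saddle (finv f) p q" using ex_saddle f by blast
  then have "p < q" using saddle_def by blast
  then obtain c k where k: "p < c" "c < q" "k \<in> T" "k \<noteq> id" "k c = c" using dense by blast
  have "f c \<noteq> c" using q k saddleD(5)[of f p q c] saddle_invD(5)[OF f(1), of p q c] by auto
  then obtain h where h: "h \<in> T" "\<And>x. x < h x" using ex_free[of k c f] f k by blast
  \<comment> \<open>The bound \<open>2\<close> leaves room for monotonicity: each \<open>x\<close>
    in \<open>[0, 1)\<close> goes at least as far as \<open>0\<close> does, and
    \<open>x + 1 < 2\<close>.\<close>
  obtain n where n: "2 < (h ^^ n) 0" using funpow_escapes[OF cont[OF h(1)]] h(2) by blast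
  have hn: "h ^^ n \<in> T" using h funpow_mem by blast
  have "x + 1 \<le> (h ^^ n) x" for x
  proof -
    obtain i where i: "0 \<le> x - of_int i" "x - of_int i < 0 + 1" using ex_fixed_frac .
    have "(h ^^ n) 0 \<le> (h ^^ n) (x - of_int i)" using le_iff[OF hn] i by blast
    then show ?thesis using n i shift_int[OF hn, of "x - of_int i" i] by simp
  qed
  then show ?thesis using hn by blast
qed

text \<open>A translate \<open>c + i\<close> with \<open>c + i \<le> x < c + i + 1\<close> is fixed,
  so \<open>f x\<close> is at least \<open>c + i\<close>, which exceeds
  \<open>x - 1\<close>.\<close>

lemma fixed_point_displacement:
  assumes f: "f \<in> T" "f c = c"
  shows "x - 1 < f x"
proof -
  obtain i where i: "c \<le> x - of_int i" "x - of_int i < c + 1" using ex_fixed_frac .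
  then show ?thesis
    using le_iff[OF f(1), of c "x - of_int i"] shift_int[OF f(1), of "x - of_int i" i] f(2) by simp
qed

end

section \<open>Automorphisms of the skew plane\<close>

text \<open>The midpoint only represents the vertical leaf over \<open>x\<close>: for an
  automorphism this is the induced map on the space of vertical leaves, and any other point of the
  leaf gives the same value.\<close>

definition hcoord :: "(real \<times> real \<Rightarrow> real \<times> real) \<Rightarrow> real \<Rightarrow> real" where
  "hcoord f x = fst (f (x, x + 1/2))"

definition vcoord :: "(real \<times> real \<Rightarrow> real \<times> real) \<Rightarrow> real \<Rightarrow> real" where
  "vcoord f y = snd (f (y - 1/2, y))"

abbreviation vleaf :: "real \<Rightarrow> (real \<times> real) set" where
  "vleaf c \<equiv> {p \<in> Pskew. fst p = c}"

abbreviation hleaf :: "real \<Rightarrow> (real \<times> real) set" where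
  "hleaf c \<equiv> {p \<in> Pskew. snd p = c}"

lemma Pskew_iff: "(x, y) \<in> Pskew \<longleftrightarrow> x < y \<and> y < x + 1"
  by (simp add: Pskew_def)

lemma vleaf_mem: "vleaf c \<in> leaves_minus"
  unfolding leaves_minus_def by blast

lemma hleaf_mem: "hleaf c \<in> leaves_plus"
  unfolding leaves_plus_def by blast

text \<open>Continuity gives \<open>u \<le> b c\<close> and \<open>b d \<le> v\<close>; a strict
  inequality would leave values in \<open>(u, v)\<close> below \<open>b c\<close> or above
  \<open>b d\<close> that an increasing map does not attain on \<open>(c, d)\<close>.\<close>

lemma strict_mono_image_interval:
  fixes b :: "real \<Rightarrow> real"
  assumes cont: "continuous_on UNIV b" and mono: "strict_mono b"
    and img: "b ` {c<..<d} = {u<..<v}" and le: "c < d" "u < v"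
  shows "b c = u" "b d = v"
proof -
  have "b ` closure {c<..<d} \<subseteq> closure {u<..<v}"
    using cont img closure_subset
    by (intro image_closure_subset) (auto intro: continuous_on_subset)
  then have *: "u \<le> b c" "b d \<le> v" using le by (auto simp: image_subset_iff)
  have lt: "b x < b y \<longleftrightarrow> x < y" for x y using mono strict_mono_less by blast
  show "b c = u"
  proof (rule ccontr)
    assume "b c \<noteq> u"
    then obtain z where z: "u < z" "z < min (b c) v" using * le dense[of u "min (b c) v"] by auto
    then obtain y where "c < y" "z = b y" using img by (metis (no_types) greaterThanLessThan_iff imageE min_less_iff_conj)
    then show False using z lt[of c y] by simp
  qed
  show "b d = v"
  proof (rule ccontr)
    assume "b d \<noteq> v"
    then obtain z where z: "max (b d) u < z" "z < v" using * le dense[of "max (b d) u" v] by auto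
    then obtain y where "y < d" "z = b y" using img by (metis (no_types) greaterThanLessThan_iff imageE max_less_iff_conj)
    then show False using z lt[of y d] by simp
  qed
qed

context
  fixes f :: "real \<times> real \<Rightarrow> real \<times> real"
  assumes aut: "skew_automorphism f"
begin

lemma aut_props: "continuous_on Pskew f" "inj_on f Pskew" "f ` Pskew = Pskew"
  using aut unfolding skew_automorphism_def homeomorphism_def by (auto intro: inj_on_inverseI)

lemma aut_image_vleaf: "f ` vleaf x = vleaf (hcoord f x)"
proof -
  have "f ` vleaf x \<in> leaves_minus" using aut vleaf_mem unfolding skew_automorphism_def by blast
  then obtain c where c: "f ` vleaf x = vleaf c" unfolding leaves_minus_def by blast
  have "f (x, x + 1/2) \<in> f ` vleaf x" by (rule imageI) (simp add: Pskew_iff)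
  then have "hcoord f x = c" using c by (simp add: hcoord_def)
  with c show ?thesis by simp
qed

lemma aut_image_hleaf: "f ` hleaf y = hleaf (vcoord f y)"
proof -
  have "f ` hleaf y \<in> leaves_plus" using aut hleaf_mem unfolding skew_automorphism_def by blast
  then obtain c where c: "f ` hleaf y = hleaf c" unfolding leaves_plus_def by blast
  have "f (y - 1/2, y) \<in> f ` hleaf y" by (rule imageI) (simp add: Pskew_iff)
  then have "vcoord f y = c" using c by (simp add: vcoord_def)
  with c show ?thesis by simp
qed

lemma aut_coords:
  assumes "(x, y) \<in> Pskew"
  shows "f (x, y) = (hcoord f x, vcoord f y)"
proof -
  have "f (x, y) \<in> f ` vleaf x" "f (x, y) \<in> f ` hleaf y" using assms by auto
  then show ?thesis unfolding aut_image_vleaf aut_image_hleaf by (auto simp: prod_eq_iff)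
qed

lemma continuous_hcoord: "continuous_on UNIV (hcoord f)"
  unfolding hcoord_def
  by (intro continuous_on_fst continuous_on_compose2[OF aut_props(1)] continuous_intros)
    (auto simp: Pskew_iff)

lemma continuous_vcoord: "continuous_on UNIV (vcoord f)"
  unfolding vcoord_def
  by (intro continuous_on_snd continuous_on_compose2[OF aut_props(1)] continuous_intros)
    (auto simp: Pskew_iff)

lemma inj_hcoord: "inj (hcoord f)"
proof (rule injI)
  fix x x' assume "hcoord f x = hcoord f x'"
  then have "f ` vleaf x = f ` vleaf x'" by (simp add: aut_image_vleaf)
  then have "vleaf x = vleaf x'" using inj_on_image_eq_iff[OF aut_props(2)] by blast
  moreover have "(x, x + 1/2) \<in> vleaf x" by (simp add: Pskew_iff)
  ultimately show "x = x'" by auto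
qed

lemma inj_vcoord: "inj (vcoord f)"
proof (rule injI)
  fix x x' assume "vcoord f x = vcoord f x'"
  then have "f ` hleaf x = f ` hleaf x'" by (simp add: aut_image_hleaf)
  then have "hleaf x = hleaf x'" using inj_on_image_eq_iff[OF aut_props(2)] by blast
  moreover have "(x - 1/2, x) \<in> hleaf x" by (simp add: Pskew_iff)
  ultimately show "x = x'" by auto
qed

lemma hcoord_monotone: "strict_mono (hcoord f) \<or> strict_antimono_on UNIV (hcoord f)"
  using injective_eq_monotone_map[of UNIV "hcoord f"] continuous_hcoord inj_hcoord by simp

text \<open>Both sides are the second coordinates of the image of the vertical leaf over
  \<open>c\<close>.\<close>

lemma vcoord_image_interval: "vcoord f ` {c<..<c + 1} = {hcoord f c<..<hcoord f c + 1}"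
proof -
  have snd_vleaf: "snd ` vleaf z = {z<..<z + 1}" for z
    by (force simp: Pskew_def image_iff)
  have "snd ` f ` vleaf c = vcoord f ` snd ` vleaf c"
    unfolding image_image by (intro image_cong) (auto simp: aut_coords)
  then show ?thesis by (simp only: aut_image_vleaf snd_vleaf)
qed

text \<open>If the vertical map reversed orientation, the two boundary lines of the strip would be exchanged,
  which forces the horizontal map to reverse orientation too.\<close>

lemma orientation_preserving:
  assumes "strict_mono (hcoord f)"
  shows "vcoord f = hcoord f" "hcoord f (x + 1) = hcoord f x + 1"
proof -
  have "strict_mono (vcoord f) \<or> strict_antimono_on UNIV (vcoord f)"
    using injective_eq_monotone_map[of UNIV "vcoord f"] continuous_vcoord inj_vcoord by simp
  moreover have "\<not> strict_antimono_on UNIV (vcoord f)"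
  proof
    assume anti: "strict_antimono_on UNIV (vcoord f)"
    \<comment> \<open>After negation the endpoint lemma applies and gives
      \<open>vcoord f c = hcoord f c + 1\<close>, so \<open>hcoord f\<close> would decrease together
      with \<open>vcoord f\<close>.\<close>
    have "strict_mono (\<lambda>y. - vcoord f y)"
      using anti by (auto simp: monotone_on_def)
    moreover have "(\<lambda>y. - vcoord f y) ` {c<..<c + 1} = {- hcoord f c - 1<..<- hcoord f c}" for c
      unfolding image_image[of uminus "vcoord f", symmetric] vcoord_image_interval
      by (simp add: image_uminus_greaterThanLessThan)
    ultimately have "- vcoord f c = - hcoord f c - 1" for c
      by (intro strict_mono_image_interval(1)[of "\<lambda>y. - vcoord f y" c "c + 1"])
        (auto intro!: continuous_intros continuous_vcoord)
    then have "hcoord f c = vcoord f c - 1" for c by (simp add: algebra_simps)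
    moreover have "vcoord f 1 < vcoord f 0" using anti by (simp add: monotone_on_def)
    moreover have "hcoord f 0 < hcoord f 1" using assms by (simp add: strict_monoD)
    ultimately show False by simp
  qed
  ultimately have mono: "strict_mono (vcoord f)" by blast
  \<comment> \<open>The left endpoint identifies the two maps; the right one then gives commutation
    with the unit translation.\<close>
  have *: "vcoord f c = hcoord f c" "vcoord f (c + 1) = hcoord f c + 1" for c
    using strict_mono_image_interval[OF continuous_vcoord mono vcoord_image_interval, of c] by auto
  show "vcoord f = hcoord f" using * by blast
  then show "hcoord f (x + 1) = hcoord f x + 1" using * by metis
qed

end

section \<open>Anosov-like actions\<close>

text \<open>Otherwise monotonicity keeps the orbit at or below \<open>y\<close>, and so its
  limit.\<close>

lemma contracting_imp_up:
  fixes a :: "real \<Rightarrow> real"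
  assumes "mono a" "(\<lambda>n. (a ^^ n) y) \<longlonglongrightarrow> d" "y < d"
  shows "y < a y"
proof (rule ccontr)
  assume "\<not> y < a y"
  then have "(a ^^ n) y \<le> y" for n
  proof (induction n)
    case (Suc n)
    then show ?case using monoD[OF assms(1), of "(a ^^ n) y" y] by simp
  qed simp
  then have "d \<le> y" by (intro LIMSEQ_le_const2[OF assms(2)]) blast
  then show False using assms(3) by simp
qed

lemma contracting_imp_down:
  fixes a :: "real \<Rightarrow> real"
  assumes "mono a" "(\<lambda>n. (a ^^ n) y) \<longlonglongrightarrow> d" "d < y"
  shows "a y < y"
proof (rule ccontr)
  assume "\<not> a y < y"
  then have "y \<le> (a ^^ n) y" for n
  proof (induction n)
    case (Suc n)
    then show ?case using monoD[OF assms(1), of y "(a ^^ n) y"] by simp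
  qed simp
  then have "y \<le> d" by (intro LIMSEQ_le_const[OF assms(2)]) blast
  then show False using assms(3) by simp
qed

locale anosov_action = group G for G (structure) +
  fixes \<phi> :: "'a \<Rightarrow> real \<times> real \<Rightarrow> real \<times> real"
  assumes anosov: "anosov_like G \<phi>"
begin

sublocale group_action G Pskew \<phi>
  using anosov unfolding anosov_like_def by blast

lemma aut: "g \<in> carrier G \<Longrightarrow> skew_automorphism (\<phi> g)"
  using anosov unfolding anosov_like_def by blast

abbreviation A :: "'a \<Rightarrow> real \<Rightarrow> real" where
  "A g \<equiv> hcoord (\<phi> g)"

section \<open>Elements preserving the orientation of the line\<close>

definition pos :: "'a set" where
  "pos = {g \<in> carrier G. strict_mono (A g)}"

lemma posD: "g \<in> pos \<Longrightarrow> g \<in> carrier G" "g \<in> pos \<Longrightarrow> strict_mono (A g)"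
  by (auto simp: pos_def)

lemma act_closed: "\<lbrakk>g \<in> carrier G; p \<in> Pskew\<rbrakk> \<Longrightarrow> \<phi> g p \<in> Pskew"
  using element_image by blast

lemma act_one: "p \<in> Pskew \<Longrightarrow> \<phi> \<one> p = p"
  using id_eq_one by (metis restrict_apply')

lemma A_comp:
  assumes "g \<in> carrier G" "h \<in> carrier G"
  shows "A (g \<otimes> h) = A g \<circ> A h"
proof
  fix x
  have mem: "(x, x + 1/2) \<in> Pskew" by (simp add: Pskew_iff)
  obtain y where y: "\<phi> h (x, x + 1/2) = (A h x, y)" using aut_coords[OF aut mem] assms by blast
  then have "(A h x, y) \<in> Pskew" using act_closed[OF assms(2) mem] by simp
  then have "\<phi> (g \<otimes> h) (x, x + 1/2) = (A g (A h x), vcoord (\<phi> g) y)"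
    using composition_rule[OF mem assms] aut_coords[OF aut] assms y by simp
  then show "A (g \<otimes> h) x = (A g \<circ> A h) x" by (simp add: hcoord_def[of "\<phi> (g \<otimes> h)"])
qed

lemma A_one: "A \<one> = id"
  using act_one by (auto simp: hcoord_def Pskew_iff)

lemma pos_comp: "\<lbrakk>g \<in> pos; h \<in> pos\<rbrakk> \<Longrightarrow> g \<otimes> h \<in> pos"
  by (simp add: pos_def A_comp strict_mono_o)

lemma pos_one: "\<one> \<in> pos"
  by (simp add: pos_def A_one strict_mono_def)

lemma neg_comp:
  assumes "g \<in> carrier G - pos" "h \<in> carrier G - pos"
  shows "g \<otimes> h \<in> pos"
proof -
  have "strict_antimono_on UNIV (A g)" "strict_antimono_on UNIV (A h)"
    using assms hcoord_monotone[OF aut] by (auto simp: pos_def)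
  then show ?thesis using assms by (simp add: pos_def A_comp monotone_on_def)
qed

lemma pos_square: "g \<in> carrier G \<Longrightarrow> g \<otimes> g \<in> pos"
  using pos_comp neg_comp by blast

lemma pos_pow: "g \<in> pos \<Longrightarrow> g [^] (n::nat) \<in> pos"
  by (induction n) (auto simp: pos_one pos_comp)

lemma A_pow: "g \<in> carrier G \<Longrightarrow> A (g [^] (n::nat)) = A g ^^ n"
  by (induction n) (auto simp: A_one A_comp funpow_Suc_right simp del: funpow.simps(2))

lemma A_inv:
  assumes "g \<in> carrier G"
  shows "A g \<circ> A (inv g) = id" "A (inv g) \<circ> A g = id"
  using assms by (simp_all add: A_comp[symmetric] A_one)

lemma pos_inv:
  assumes "g \<in> pos"
  shows "inv g \<in> pos"
proof -
  have "A (inv g) x < A (inv g) y" if "x < y" for x y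
  proof -
    have "A g (A (inv g) x) < A g (A (inv g) y)"
      using A_inv(1)[of g] that posD(1)[OF assms] by (simp add: fun_eq_iff)
    then show ?thesis using strict_mono_less[OF posD(2)[OF assms]] by blast
  qed
  then show ?thesis using posD(1)[OF assms] by (simp add: pos_def strict_mono_def)
qed

lemma act_pos:
  assumes "g \<in> pos" "(x, y) \<in> Pskew"
  shows "\<phi> g (x, y) = (A g x, A g y)"
  using aut_coords[OF aut assms(2), of g] orientation_preserving(1)[OF aut, of g] posD[OF assms(1)]
  by simp

lemma topo_contracting_pos:
  assumes "g \<in> pos" "topo_contracting G \<phi> g (vleaf c) (c, d)" "c < y" "y < c + 1"
  shows "(\<lambda>n. (A g ^^ n) y) \<longlonglongrightarrow> d"
proof -
  have mem: "(c, y) \<in> Pskew" using assms by (simp add: Pskew_iff)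
  then have "(\<lambda>n::nat. \<phi> (g [^] n) (c, y)) \<longlonglongrightarrow> (c, d)"
    using assms(2) unfolding topo_contracting_def by auto
  then have "(\<lambda>n::nat. snd (\<phi> (g [^] n) (c, y))) \<longlonglongrightarrow> d"
    using tendsto_snd by fastforce
  then show ?thesis
    using act_pos[OF pos_pow[OF assms(1)] mem] A_pow posD(1)[OF assms(1)] by simp
qed

lemma fixes_vleaf_iff:
  assumes "g \<in> carrier G"
  shows "\<phi> g ` vleaf c = vleaf c \<longleftrightarrow> A g c = c"
proof -
  have "(z, z + 1/2) \<in> vleaf z" for z by (simp add: Pskew_iff)
  then have "vleaf z = vleaf c \<longleftrightarrow> z = c" for z by (metis (mono_tags, lifting) fst_conv mem_Collect_eq)
  then show ?thesis by (simp add: aut_image_vleaf[OF aut[OF assms]])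
qed

lemma A1_vleaf:
  assumes "g \<in> carrier G" "g \<noteq> \<one>" "A g c = c"
  obtains d where "c < d" "d < c + 1" "\<phi> g (c, d) = (c, d)"
    "topo_contracting G \<phi> g (vleaf c) (c, d) \<or> topo_contracting G \<phi> (inv g) (vleaf c) (c, d)"
proof -
  have "fixes_leaf G \<phi> g (vleaf c)"
    using assms fixes_vleaf_iff by (simp add: fixes_leaf_def)
  then obtain x where x: "x \<in> vleaf c" "\<phi> g x = x"
    "topo_contracting G \<phi> g (leaf_minus_through x) x \<or> topo_expanding G \<phi> g (leaf_minus_through x) x"
    using anosov vleaf_mem[of c] unfolding anosov_like_def by blast
  obtain d where d: "x = (c, d)" using x(1) by (cases x) auto
  then have "leaf_minus_through x = vleaf c" by (simp add: leaf_minus_through_def)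
  then show ?thesis using that[of d] x d by (auto simp: Pskew_iff topo_expanding_def)
qed

section \<open>The maps of the line induced by orientation-preserving elements\<close>

definition T :: "(real \<Rightarrow> real) set" where
  "T = A ` pos"

text \<open>The vertical leaf over \<open>c\<close> is a copy of \<open>(c, c + 1)\<close> on which
  \<open>g\<close> acts by \<open>f\<close>. Condition (A1) gives a point \<open>d\<close> to which
  this interval contracts under \<open>g\<close>, whence \<open>saddle f d (c + 1)\<close>, or under
  the inverse, whence \<open>saddle f c d\<close>.\<close>

lemma T_saddle:
  assumes f: "f \<in> T" "f \<noteq> id" "f c = c"
  shows "\<exists>d. saddle f c d \<or> saddle f d (c + 1)"
proof -
  obtain g where g: "g \<in> pos" "f = A g" using f unfolding T_def by blast
  have gc: "g \<in> carrier G" and fm: "mono f" and fm': "mono (A (inv g))"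
    using posD[OF g(1)] posD(2)[OF pos_inv[OF g(1)]] g(2) by (auto simp: strict_mono_mono)
  have "g \<noteq> \<one>" using f g A_one by auto
  then obtain d where d: "c < d" "d < c + 1" "\<phi> g (c, d) = (c, d)"
    "topo_contracting G \<phi> g (vleaf c) (c, d) \<or> topo_contracting G \<phi> (inv g) (vleaf c) (c, d)"
    using A1_vleaf[OF gc, of c] f(3) g(2) by blast
  have fd: "f d = d" using act_pos[OF g(1), of c d] d g by (simp add: Pskew_iff)
  have shift: "f (x + 1) = f x + 1" for x
    using orientation_preserving(2)[OF aut[OF gc]] posD(2)[OF g(1)] g by simp
  from d(4) have "saddle f c d \<or> saddle f d (c + 1)"
  proof
    assume con: "topo_contracting G \<phi> g (vleaf c) (c, d)"
    have up: "x < f x" if "c < x" "x < d" for x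
      using contracting_imp_up[OF fm] topo_contracting_pos[OF g(1) con, of x] that d g by simp
    have down: "f x < x" if "d < x" "x < c + 1" for x
      using contracting_imp_down[OF fm] topo_contracting_pos[OF g(1) con, of x] that d g by simp
    have "x < f x" if "c + 1 < x" "x < d + 1" for x
      using up[of "x - 1"] shift[of "x - 1"] that by simp
    then show ?thesis
      using down d f fd shift unfolding saddle_def by auto
  next
    assume con: "topo_contracting G \<phi> (inv g) (vleaf c) (c, d)"
    have inv: "f (A (inv g) x) = x" for x using A_inv(1)[OF gc] g by (simp add: fun_eq_iff)
    have "f x < x" if "c < x" "x < d" for x
      using contracting_imp_up[OF fm' topo_contracting_pos[OF pos_inv[OF g(1)] con, of x]] that d
        strict_monoD[OF posD(2)[OF g(1)], of x "A (inv g) x"] inv[of x] g by simp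
    moreover have "x < f x" if "d < x" "x < c + 1" for x
      using contracting_imp_down[OF fm' topo_contracting_pos[OF pos_inv[OF g(1)] con, of x]] that d
        strict_monoD[OF posD(2)[OF g(1)], of "A (inv g) x" x] inv[of x] g by simp
    ultimately show ?thesis
      using d f fd unfolding saddle_def by auto
  qed
  then show ?thesis by blast
qed

sublocale hyperbolic_lifts T
proof
  show "id \<in> T" using pos_one A_one unfolding T_def by (metis imageI)
  show "f \<circ> g \<in> T" if "f \<in> T" "g \<in> T" for f g
  proof -
    obtain u v where "u \<in> pos" "v \<in> pos" "f = A u" "g = A v" using \<open>f \<in> T\<close> \<open>g \<in> T\<close> unfolding T_def by blast
    then have "u \<otimes> v \<in> pos" "f \<circ> g = A (u \<otimes> v)" using pos_comp A_comp posD(1) by auto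
    then show ?thesis unfolding T_def by blast
  qed
  show "\<exists>g\<in>T. f \<circ> g = id \<and> g \<circ> f = id" if "f \<in> T" for f
    using that pos_inv A_inv posD(1) unfolding T_def by blast
  show "strict_mono f" if "f \<in> T" for f using that posD unfolding T_def by auto
  show "continuous_on UNIV f" if "f \<in> T" for f
    using that posD(1) continuous_hcoord[OF aut] unfolding T_def by auto
  show "f (x + 1) = f x + 1" if "f \<in> T" for f x
    using that posD orientation_preserving(2)[OF aut] unfolding T_def by auto
qed (rule T_saddle)

text \<open>A map whose square is the identity cannot contract a leaf to a point.\<close>

lemma square_not_id:
  assumes g: "g \<in> carrier G" "g \<noteq> \<one>" "A g c = c"
  shows "A (g \<otimes> g) \<noteq> id"
proof
  assume id: "A (g \<otimes> g) = id"
  have sq: "\<phi> (g \<otimes> g) p = p" if "p \<in> Pskew" for p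
    using act_pos[OF pos_square[OF g(1)], of "fst p" "snd p"] that id by simp
  have sq': "\<phi> (inv g \<otimes> inv g) p = p" if p: "p \<in> Pskew" for p
  proof -
    have "\<phi> (inv (g \<otimes> g)) (\<phi> (g \<otimes> g) p) = \<phi> \<one> p"
      using composition_rule[OF p, of "inv (g \<otimes> g)" "g \<otimes> g"] g
      by (simp del: inv_mult_group)
    then show ?thesis using sq[OF p] act_one[OF p] g by (simp add: inv_mult_group)
  qed
  have not_contracting: "\<not> topo_contracting G \<phi> u (vleaf c) x"
    if u: "u \<in> carrier G" "\<And>p. p \<in> Pskew \<Longrightarrow> \<phi> (u \<otimes> u) p = p" for u x
  proof
    assume con: "topo_contracting G \<phi> u (vleaf c) x"
    have eq: "p = x" if p: "p \<in> vleaf c" for p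
    proof -
      have "\<phi> (u [^] (2 * n)) p = p" for n :: nat
      proof (induction n)
        case (Suc n)
        have "u [^] (2 * Suc n) = u [^] (2 * n) \<otimes> (u \<otimes> u)" using u(1) by (simp add: m_assoc)
        then show ?case using composition_rule[of p "u [^] (2 * n)" "u \<otimes> u"] u p Suc by simp
      qed (use act_one p in simp)
      moreover have "(\<lambda>n::nat. \<phi> (u [^] n) p) \<longlonglongrightarrow> x"
        using con p unfolding topo_contracting_def by blast
      then have "(\<lambda>n::nat. \<phi> (u [^] (2 * n)) p) \<longlonglongrightarrow> x"
        using LIMSEQ_subseq_LIMSEQ[of _ x "\<lambda>n. 2 * n"] by (auto simp: strict_mono_def o_def)
      ultimately show ?thesis by (simp add: LIMSEQ_const_iff)
    qed
    have "(c, c + 1/2) \<in> vleaf c" "(c, c + 1/3) \<in> vleaf c" by (auto simp: Pskew_iff)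
    then have "(c, c + 1/2) = (c, c + 1/3)" using eq by metis
    then show False by simp
  qed
  show False
    by (rule A1_vleaf[OF g])
      (use not_contracting[OF g(1) sq] not_contracting[OF inv_closed[OF g(1)] sq'] in blast)
qed

text \<open>By (A2) a fixed vertical leaf meets the open strip over \<open>(a, b)\<close>. The
  element fixing it may reverse orientation, so its square is taken, which still fixes the leaf and
  does not act as the identity.\<close>

lemma T_fixed_dense:
  assumes "a < b"
  shows "\<exists>c f. a < c \<and> c < b \<and> f \<in> T \<and> f \<noteq> id \<and> f c = c"
proof -
  let ?U = "\<Union>{l \<in> leaves_minus. \<exists>g. fixes_leaf G \<phi> g l}"
  let ?m = "(a + b) / 2"
  have "(?m, ?m + 1/2) \<in> closure ?U"
    using anosov unfolding anosov_like_def by (auto simp: Pskew_iff subset_iff)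
  moreover have "open {p :: real \<times> real. a < fst p \<and> fst p < b}"
    by (intro open_Collect_conj open_Collect_less continuous_intros)
  moreover have "(?m, ?m + 1/2) \<in> {p. a < fst p \<and> fst p < b}" using assms by (simp add: field_simps)
  ultimately obtain p where p: "a < fst p" "fst p < b" "p \<in> ?U"
    unfolding closure_iff_nhds_not_empty by blast
  then obtain l g where l: "p \<in> l" "l \<in> leaves_minus" "fixes_leaf G \<phi> g l" by blast
  then have "l = vleaf (fst p)" unfolding leaves_minus_def by auto
  then have g: "g \<in> carrier G" "g \<noteq> \<one>" "A g (fst p) = fst p"
    using l fixes_vleaf_iff unfolding fixes_leaf_def by auto
  then have "A (g \<otimes> g) \<in> T" "A (g \<otimes> g) (fst p) = fst p"
    using pos_square[OF g(1)] A_comp[OF g(1,1)] unfolding T_def by (blast, simp)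
  then show ?thesis using p square_not_id[OF g] by blast
qed

section \<open>Covering the group by finitely many translates of the free elements\<close>

lemma acts_freelyI: "\<lbrakk>g \<in> carrier G; \<And>x. A g x \<noteq> x\<rbrakk> \<Longrightarrow> acts_freely \<phi> g"
  using aut_coords[OF aut, of g] unfolding acts_freely_def by auto

text \<open>With a fixed point, \<open>A g\<close> lowers every point by less than one, which a map
  \<open>A h\<close> raising every point by at least one outweighs. Without a fixed point,
  \<open>g\<close> is already free.\<close>

lemma ex_pos_translate_free:
  "\<exists>h\<in>carrier G. \<forall>g\<in>pos. acts_freely \<phi> g \<or> acts_freely \<phi> (h \<otimes> g)"
proof -
  obtain h where h: "h \<in> pos" "\<And>x. x + 1 \<le> A h x"
    using ex_large_translation[OF T_fixed_dense] unfolding T_def by blast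
  have "acts_freely \<phi> (h \<otimes> g)" if g: "g \<in> pos" and fix_c: "A g c = c" for g c
  proof (rule acts_freelyI)
    fix x
    have "x - 1 < A g x" using fixed_point_displacement[of "A g" c x] g fix_c by (simp add: T_def)
    then show "A (h \<otimes> g) x \<noteq> x"
      using h(2)[of "A g x"] A_comp posD(1)[OF g] posD(1)[OF h(1)] by simp
  qed (use g h posD(1) in simp)
  then have "\<forall>g\<in>pos. acts_freely \<phi> g \<or> acts_freely \<phi> (h \<otimes> g)"
    using acts_freelyI posD(1) by blast
  then show ?thesis using posD(1)[OF h(1)] by blast
qed

lemma finite_translates_free:
  obtains U V where "finite U" "finite V" "U \<subseteq> carrier G" "V \<subseteq> carrier G"
    "\<And>g. g \<in> carrier G \<Longrightarrow> \<exists>u\<in>U. \<exists>v\<in>V. acts_freely \<phi> (u \<otimes> g \<otimes> v)"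
proof -
  obtain h where h: "h \<in> carrier G"
    "\<And>g. g \<in> pos \<Longrightarrow> acts_freely \<phi> g \<or> acts_freely \<phi> (h \<otimes> g)"
    using ex_pos_translate_free by blast
  \<comment> \<open>Any orientation-reversing element serves; if there is none, the condition is
    vacuous.\<close>
  obtain r where r: "r \<in> carrier G" "\<And>g. g \<in> carrier G - pos \<Longrightarrow> g \<otimes> r \<in> pos"
    using neg_comp by (cases "carrier G \<subseteq> pos") blast+
  have free: "\<exists>u\<in>{\<one>, h}. acts_freely \<phi> (u \<otimes> g)" if "g \<in> pos" for g
    using h that posD(1) by auto
  have "\<exists>u\<in>{\<one>, h}. \<exists>v\<in>{\<one>, r}. acts_freely \<phi> (u \<otimes> g \<otimes> v)" if g: "g \<in> carrier G" for g
  proof (cases "g \<in> pos")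
    case True
    then show ?thesis using free[of g] g h r by auto
  next
    case False
    then show ?thesis using free[of "g \<otimes> r"] r g h by (auto simp: m_assoc)
  qed
  then show ?thesis using that[of "{\<one>, h}" "{\<one>, r}"] h r by auto
qed

end

section \<open>Counting in word balls\<close>

context group
begin

abbreviation word :: "'a list \<Rightarrow> 'a" where
  "word w \<equiv> foldr (\<otimes>) w \<one>"

lemma word_closed: "set w \<subseteq> carrier G \<Longrightarrow> word w \<in> carrier G"
  by (induction w) auto

lemma word_append:
  "\<lbrakk>set v \<subseteq> carrier G; set w \<subseteq> carrier G\<rbrakk> \<Longrightarrow> word (v @ w) = word v \<otimes> word w"
  by (induction v) (auto simp: word_closed m_assoc)

lemma word_ballI: "\<lbrakk>set w \<subseteq> S \<union> (\<lambda>s. inv s) ` S; length w \<le> n\<rbrakk> \<Longrightarrow> word w \<in> word_ball G S n"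
  unfolding word_ball_def by blast

lemma word_ballE:
  assumes "x \<in> word_ball G S n"
  obtains w where "x = word w" "set w \<subseteq> S \<union> (\<lambda>s. inv s) ` S" "length w \<le> n"
  using assms unfolding word_ball_def by blast

lemma one_in_word_ball: "\<one> \<in> word_ball G S n"
  using word_ballI[of "[]" S n] by simp

context
  fixes S :: "'a set"
  assumes S: "finite S" "S \<subseteq> carrier G"
begin

abbreviation letters :: "'a set" where
  "letters \<equiv> S \<union> (\<lambda>s. inv s) ` S"

lemma letters: "finite letters" "letters \<subseteq> carrier G"
  using S by auto

lemma word_ball_subset: "word_ball G S n \<subseteq> carrier G"
proof
  fix x assume "x \<in> word_ball G S n"
  then obtain w where "x = word w" "set w \<subseteq> letters" by (rule word_ballE)
  then show "x \<in> carrier G" using word_closed[of w] letters(2) by blast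
qed

lemma word_ball_mult:
  assumes "x \<in> word_ball G S m" "y \<in> word_ball G S n"
  shows "x \<otimes> y \<in> word_ball G S (m + n)"
proof -
  obtain v where v: "x = word v" "set v \<subseteq> letters" "length v \<le> m" using assms(1) by (rule word_ballE)
  obtain w where w: "y = word w" "set w \<subseteq> letters" "length w \<le> n" using assms(2) by (rule word_ballE)
  have "x \<otimes> y = word (v @ w)"
    unfolding v(1) w(1)
    using word_append[OF subset_trans[OF v(2) letters(2)] subset_trans[OF w(2) letters(2)]] by (rule sym)
  then show ?thesis using word_ballI[of "v @ w" S "m + n"] v w by simp
qed

lemma word_ball_mono: "m \<le> n \<Longrightarrow> word_ball G S m \<subseteq> word_ball G S n"
  unfolding word_ball_def by fastforce

lemma word_ball_Suc_subset:
  "word_ball G S (Suc n) \<subseteq> word_ball G S n \<union> (\<lambda>(s, x). s \<otimes> x) ` (letters \<times> word_ball G S n)"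
proof
  fix x assume "x \<in> word_ball G S (Suc n)"
  then obtain w where w: "x = word w" "set w \<subseteq> letters" "length w \<le> Suc n" by (rule word_ballE)
  show "x \<in> word_ball G S n \<union> (\<lambda>(s, x). s \<otimes> x) ` (letters \<times> word_ball G S n)"
  proof (cases w)
    case Nil
    then show ?thesis using w one_in_word_ball by simp
  next
    case (Cons s v)
    then have "x = (\<lambda>(s, x). s \<otimes> x) (s, word v)" "s \<in> letters" "word v \<in> word_ball G S n"
      using w word_ballI[of v S n] by auto
    then show ?thesis by blast
  qed
qed

lemma finite_word_ball: "finite (word_ball G S n)"
proof (induction n)
  case 0
  have "word_ball G S 0 \<subseteq> {\<one>}" by (auto elim: word_ballE)
  then show ?case using finite_subset by blast
next
  case (Suc n)
  then show ?case
    using finite_subset[OF word_ball_Suc_subset] letters(1) by blast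
qed

text \<open>One more letter multiplies the size of a ball by at most
  \<open>1 + card letters\<close>.\<close>

lemma card_word_ball_add:
  "card (word_ball G S (n + k)) \<le> (1 + card letters) ^ k * card (word_ball G S n)"
proof (induction k)
  case (Suc k)
  let ?B = "word_ball G S (n + k)"
  have "card (word_ball G S (n + Suc k)) \<le> card (?B \<union> (\<lambda>(s, x). s \<otimes> x) ` (letters \<times> ?B))"
    using word_ball_Suc_subset[of "n + k"] finite_word_ball letters(1) by (intro card_mono) auto
  also have "\<dots> \<le> card ?B + card ((\<lambda>(s, x). s \<otimes> x) ` (letters \<times> ?B))" by (rule card_Un_le)
  also have "\<dots> \<le> card ?B + card (letters \<times> ?B)"
    using finite_word_ball letters(1) by (intro add_left_mono card_image_le) blast
  also have "\<dots> = (1 + card letters) * card ?B" by (simp add: card_cartesian_product)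
  also have "\<dots> \<le> (1 + card letters) * ((1 + card letters) ^ k * card (word_ball G S n))"
    using Suc by (rule mult_left_mono) simp
  finally show ?case by (simp only: power_Suc mult.assoc)
qed simp

section \<open>From finite covers by translates to positive proportion\<close>

lemma generate_in_word_ball:
  assumes "x \<in> generate G S"
  shows "\<exists>n. x \<in> word_ball G S n"
  using assms
proof (induction rule: generate.induct)
  case one
  then show ?case using one_in_word_ball by blast
next
  case (incl h)
  then have "word [h] = h" using S(2) by auto
  moreover have "word [h] \<in> word_ball G S 1" using incl by (intro word_ballI) auto
  ultimately show ?case by auto
next
  case (inv h)
  then have "word [inv h] = inv h" using S(2) by auto
  moreover have "word [inv h] \<in> word_ball G S 1" using inv by (intro word_ballI) auto
  ultimately show ?case by auto
next
  case (eng x y)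
  then show ?case using word_ball_mult by blast
qed

lemma finite_in_word_ball:
  assumes "finite U" "U \<subseteq> generate G S"
  shows "\<exists>n. U \<subseteq> word_ball G S n"
  using assms
proof (induction U rule: finite_induct)
  case (insert x U)
  then obtain m n where "U \<subseteq> word_ball G S m" "x \<in> word_ball G S n"
    using generate_in_word_ball by blast
  then have "insert x U \<subseteq> word_ball G S (max m n)"
    using word_ball_mono[of m "max m n"] word_ball_mono[of n "max m n"] by auto
  then show ?case by blast
qed simp

text \<open>Each \<open>g\<close> in the ball of radius \<open>n\<close> is recovered from
  \<open>u\<close>, \<open>v\<close> and the element \<open>u g v\<close> of \<open>F\<close>, which
  lies in the ball of radius \<open>n + k\<close>. The factor \<open>M\<close> counts the pairs
  \<open>(u, v)\<close>, and bounded growth over \<open>k\<close> steps costs the factor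
  \<open>C\<close>.\<close>

lemma syndetic_positive_proportion:
  assumes gen: "generate G S = carrier G"
    and UV: "finite U" "finite V" "U \<subseteq> carrier G" "V \<subseteq> carrier G"
    and cover: "\<And>g. g \<in> carrier G \<Longrightarrow> \<exists>u\<in>U. \<exists>v\<in>V. u \<otimes> g \<otimes> v \<in> F"
  shows "\<exists>\<delta>>0. \<forall>\<^sub>F n in sequentially.
    \<delta> * real (card (word_ball G S n)) \<le> real (card (F \<inter> word_ball G S n))"
proof -
  obtain a b where ab: "U \<subseteq> word_ball G S a" "V \<subseteq> word_ball G S b"
    using finite_in_word_ball UV gen by metis
  define k where "k = a + b"
  define M where "M = card U * card V"
  define C where "C = (1 + card letters) ^ k"
  have le: "card (word_ball G S n) \<le> M * card (F \<inter> word_ball G S (n + k))" for n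
  proof -
    let ?F = "F \<inter> word_ball G S (n + k)"
    have "word_ball G S n \<subseteq> (\<lambda>(u, v, f). inv u \<otimes> f \<otimes> inv v) ` (U \<times> V \<times> ?F)"
    proof
      fix g assume g: "g \<in> word_ball G S n"
      then have gc: "g \<in> carrier G" using word_ball_subset by blast
      obtain u v where uv: "u \<in> U" "v \<in> V" "u \<otimes> g \<otimes> v \<in> F" using cover[OF gc] by blast
      then have c: "u \<in> carrier G" "v \<in> carrier G" using UV by auto
      have "u \<otimes> g \<otimes> v \<in> word_ball G S ((a + n) + b)"
        using word_ball_mult g uv ab by blast
      then have "u \<otimes> g \<otimes> v \<in> ?F" using uv by (simp add: k_def ac_simps)
      moreover have "inv u \<otimes> (u \<otimes> g \<otimes> v) \<otimes> inv v = g"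
        using c gc by (simp add: m_assoc flip: m_assoc[of "inv u" u])
      ultimately show "g \<in> (\<lambda>(u, v, f). inv u \<otimes> f \<otimes> inv v) ` (U \<times> V \<times> ?F)"
        using uv by (intro image_eqI[of _ _ "(u, v, u \<otimes> g \<otimes> v)"]) auto
    qed
    moreover have fin: "finite (U \<times> V \<times> ?F)" using UV finite_word_ball by blast
    ultimately have "card (word_ball G S n) \<le> card (U \<times> V \<times> ?F)"
      by (rule surj_card_le[rotated])
    then show ?thesis by (simp add: card_cartesian_product M_def mult.assoc)
  qed
  have "0 < card (word_ball G S 0)"
    using finite_word_ball one_in_word_ball card_gt_0_iff by blast
  \<comment> \<open>The ball of radius \<open>0\<close> contains the unit, so the bound just proved
    excludes \<open>M = 0\<close>.\<close>
  then have M: "0 < M" using le[of 0] by (cases "M = 0") auto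
  have C: "0 < C" by (simp add: C_def)
  have "1 / (real C * real M) * real (card (word_ball G S n)) \<le> real (card (F \<inter> word_ball G S n))"
    if "k \<le> n" for n
  proof -
    obtain m where n: "n = m + k" using \<open>k \<le> n\<close> by (metis le_add_diff_inverse2)
    have "card (word_ball G S n) \<le> C * card (word_ball G S m)"
      unfolding n C_def by (rule card_word_ball_add)
    also have "\<dots> \<le> C * (M * card (F \<inter> word_ball G S n))"
      using le[of m] unfolding n by (rule mult_left_mono) simp
    finally have "real (card (word_ball G S n)) \<le> real (C * (M * card (F \<inter> word_ball G S n)))"
      by (rule of_nat_mono)
    then show ?thesis using C M by (simp add: field_simps)
  qed
  then show ?thesis
    using C M by (intro exI[of _ "1 / (real C * real M)"]) (auto simp: eventually_sequentially)
qed

text \<open>The factor \<open>\<delta>\<close> shifts the logarithm by the constant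
  \<open>ln \<delta>\<close>, which disappears in the limit after division by \<open>n\<close>; the
  other inequality is monotonicity of cardinality.\<close>

lemma positive_proportion_crit_exp:
  assumes \<delta>: "0 < \<delta>"
    and dens: "\<forall>\<^sub>F n in sequentially.
      \<delta> * real (card (word_ball G S n)) \<le> real (card (F \<inter> word_ball G S n))"
  shows "crit_exp G S F = crit_exp G S (carrier G)"
proof (rule antisym)
  have carrier: "carrier G \<inter> word_ball G S n = word_ball G S n" for n
    using word_ball_subset by blast
  have pos: "0 < card (word_ball G S n)" for n
    using finite_word_ball one_in_word_ball card_gt_0_iff by blast
  have ev: "\<forall>\<^sub>F n in sequentially. 0 < n \<and>
      \<delta> * real (card (word_ball G S n)) \<le> real (card (F \<inter> word_ball G S n))"
    using dens eventually_gt_at_top[of 0] by eventually_elim simp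
  show "crit_exp G S F \<le> crit_exp G S (carrier G)"
    unfolding crit_exp_def carrier
  proof (rule Limsup_mono, use ev in eventually_elim)
    case (elim n)
    have "0 < \<delta> * real (card (word_ball G S n))" using \<delta> pos by simp
    then have "0 < real (card (F \<inter> word_ball G S n))" using elim by linarith
    moreover have "card (F \<inter> word_ball G S n) \<le> card (word_ball G S n)"
      using finite_word_ball by (intro card_mono) auto
    ultimately show ?case using elim pos by (simp add: divide_right_mono)
  qed
  have "(\<lambda>n. ln \<delta> / real n) \<longlonglongrightarrow> 0" by (rule lim_const_over_n)
  then have lim: "(\<lambda>n. ereal (ln \<delta> / real n)) \<longlonglongrightarrow> 0" by (simp add: zero_ereal_def)
  have "crit_exp G S (carrier G) =
      limsup (\<lambda>n. ereal (ln \<delta> / real n) + ereal (ln (real (card (word_ball G S n))) / real n))"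
    unfolding crit_exp_def carrier using ereal_limsup_lim_add[OF lim] by (simp del: plus_ereal.simps)
  also have "\<dots> \<le> crit_exp G S F"
    unfolding crit_exp_def
  proof (rule Limsup_mono, use ev in eventually_elim)
    case (elim n)
    have p: "0 < \<delta> * real (card (word_ball G S n))" using \<delta> pos by simp
    then have "ln (\<delta> * real (card (word_ball G S n))) \<le> ln (real (card (F \<inter> word_ball G S n)))"
      using elim by (intro ln_mono) auto
    then have "ln \<delta> + ln (real (card (word_ball G S n))) \<le> ln (real (card (F \<inter> word_ball G S n)))"
      using \<delta> pos[of n] by (simp add: ln_mult)
    then show ?case by (simp add: divide_right_mono flip: add_divide_distrib)
  qed
  finally show "crit_exp G S (carrier G) \<le> crit_exp G S F" .
qed

lemma positive_proportion_limsup: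
  assumes \<delta>: "0 < \<delta>"
    and dens: "\<forall>\<^sub>F n in sequentially.
      \<delta> * real (card (word_ball G S n)) \<le> real (card (F \<inter> word_ball G S n))"
  shows "0 < limsup (\<lambda>n. ereal (real (card (F \<inter> word_ball G S n)) / real (card (word_ball G S n))))"
proof -
  have pos: "0 < card (word_ball G S n)" for n
    using finite_word_ball one_in_word_ball card_gt_0_iff by blast
  have "0 < ereal \<delta>" using \<delta> by simp
  also have "ereal \<delta> \<le> limsup (\<lambda>n. ereal (real (card (F \<inter> word_ball G S n)) / real (card (word_ball G S n))))"
    using dens by (intro le_Limsup) (auto elim!: eventually_mono simp: pos pos_le_divide_eq)
  finally show ?thesis .
qed

end
end

theorem theorem6p5:
  fixes G :: "('g, 'b) monoid_scheme" and \<phi> :: "'g \<Rightarrow> real \<times> real \<Rightarrow> real \<times> real"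
  assumes "group G"
    and "\<exists>S. finite_generating_set G S"
    and "anosov_like G \<phi>"
  defines "Free \<equiv> {g \<in> carrier G. acts_freely \<phi> g}"
  shows "\<forall>S. finite_generating_set G S \<longrightarrow>
           crit_exp G S Free = crit_exp G S (carrier G) \<and>
           limsup (\<lambda>n. ereal (real (card (Free \<inter> word_ball G S n)) / real (card (word_ball G S n))))
             > 0"
proof (intro allI impI)
  fix S assume "finite_generating_set G S"
  then have S: "finite S" "S \<subseteq> carrier G" "generate G S = carrier G"
    by (auto simp: finite_generating_set_def)
  interpret anosov_action G \<phi>
    by (intro anosov_action.intro anosov_action_axioms.intro assms(1,3))
  \<comment> \<open>These sets come from the action alone; \<open>S\<close> enters only through the
    counting that follows.\<close>
  obtain U V where UV: "finite U" "finite V" "U \<subseteq> carrier G" "V \<subseteq> carrier G"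
    and free: "\<And>g. g \<in> carrier G \<Longrightarrow> \<exists>u\<in>U. \<exists>v\<in>V. acts_freely \<phi> (u \<otimes>\<^bsub>G\<^esub> g \<otimes>\<^bsub>G\<^esub> v)"
    using finite_translates_free by blast
  have cover: "\<exists>u\<in>U. \<exists>v\<in>V. u \<otimes>\<^bsub>G\<^esub> g \<otimes>\<^bsub>G\<^esub> v \<in> Free" if g: "g \<in> carrier G" for g
  proof -
    obtain u v where uv: "u \<in> U" "v \<in> V" "acts_freely \<phi> (u \<otimes>\<^bsub>G\<^esub> g \<otimes>\<^bsub>G\<^esub> v)"
      using free[OF g] by blast
    moreover have "u \<otimes>\<^bsub>G\<^esub> g \<otimes>\<^bsub>G\<^esub> v \<in> carrier G"
      using uv(1,2) UV(3,4) g by (intro m_closed) auto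
    ultimately show ?thesis unfolding Free_def by blast
  qed
  obtain \<delta> where \<delta>: "\<delta> > 0" "\<forall>\<^sub>F n in sequentially.
      \<delta> * real (card (word_ball G S n)) \<le> real (card (Free \<inter> word_ball G S n))"
    using syndetic_positive_proportion[OF S UV cover] by blast
  show "crit_exp G S Free = crit_exp G S (carrier G) \<and>
      limsup (\<lambda>n. ereal (real (card (Free \<inter> word_ball G S n)) / real (card (word_ball G S n)))) > 0"
    using positive_proportion_crit_exp[OF S(1,2) \<delta>] positive_proportion_limsup[OF S(1,2) \<delta>] by blast
qed

end
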